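(* Let $k_i>0$ for $i=1,\dots,5$, let $m\in\mathbb{R}$, and let $e_2^m=(0,0,0,0,m)\in\mathbb{R}^5$. Consider the controlled fractional $5D$ Maxwell-Bloch system with $x_e=e_2^m$, i.e. $$D_t^{\alpha}x^1=x^3-k_1x^1,\quad D_t^{\alpha}x^2=x^4-k_2x^2,\quad D_t^{\alpha}x^3=x^1x^5-k_3x^3,\quad D_t^{\alpha}x^4=x^2x^5-k_4x^4,$$ $$D_t^{\alpha}x^5=-(x^1x^3+x^2x^4)-k_5(x^5-m).$$ Then the equilibrium state $e_2^m$ of this system is locally asymptotically stable for all $\alpha\in(0,1]$ if one of the following conditions holds: (1) $|k_1-k_3|=|k_2-k_4|$ and $m=-\frac14(k_1-k_3)^2\neq 0$; (2) $\max\{-\frac14(k_1-k_3)^2,\,-\frac14(k_2-k_4)^2\}<m<\min\{k_1k_3,\,k_2k_4\}$; (3) $-\frac14(k_1-k_3)^2<m<\min\{-\frac14(k_2-k_4)^2,\,k_1k_3\}$; (4) $-\frac14(k_2-k_4)^2<m<\min\{-\frac14(k_1-k_3)^2,\,k_2k_4\}$; (5) $m<\min\{-\frac14(k_1-k_3)^2,\,-\frac14(k_2-k_4)^2\}$.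
   Context: For $\alpha\in(0,1)$, $D_t^{\alpha}$ denotes the Caputo fractional derivative of order $\alpha$ with base point $0$, $D_t^{\alpha}f=J^{1-\alpha}f'$, where $J^{\beta}f(t)=\frac{1}{\Gamma(\beta)}\int_0^t(t-s)^{\beta-1}f(s)\,ds$; for $\alpha=1$, $D_t^{\alpha}=d/dt$. Superscripts on $x$ denote components. An initial value problem $D_t^\alpha x=f(x)$, $x(0)=x_0$ is understood through the equivalent Volterra equation $x(t)=x_0+\frac{1}{\Gamma(\alpha)}\int_0^t(t-s)^{\alpha-1}f(x(s))\,ds$ with $x$ continuous. An equilibrium state is a zero of the right-hand side. An equilibrium state $x_e$ is locally asymptotically stable if it is Lyapunov stable (for every $\varepsilon>0$ there is $\delta>0$ such that $\|x(0)-x_e\|<\delta$ implies $\|x(t)-x_e\|<\varepsilon$ for all $t\ge0$) and there is $\delta_0>0$ such that $\|x(0)-x_e\|<\delta_0$ implies $\lim_{t\to\infty}\|x(t)-x_e\|=0$. *)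

theory Defs
  imports "HOL-Analysis.Analysis"
begin

(* At the endpoint s = t the integrand is 0 since 0 powr _ = 0 in HOL, also for
   \<beta> = 1; this single point does not affect the integral. *)
definition riemann_liouville :: "real \<Rightarrow> (real \<Rightarrow> 'a::euclidean_space) \<Rightarrow> real \<Rightarrow> 'a" where
  "riemann_liouville \<beta> f t =
     (1 / Gamma \<beta>) *\<^sub>R integral {0..t} (\<lambda>s. (t - s) powr (\<beta> - 1) *\<^sub>R f s)"

(* Solutions on [0, \<infinity>) of the initial value problem D^\<alpha> x = f x, x 0 = x0, where D^\<alpha>
   is the Caputo derivative with base point 0 (the ordinary derivative for \<alpha> = 1),
   understood through the equivalent Volterra equation. *)
definition caputo_solution ::
  "real \<Rightarrow> ('a::euclidean_space \<Rightarrow> 'a) \<Rightarrow> 'a \<Rightarrow> (real \<Rightarrow> 'a) \<Rightarrow> bool" where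
  "caputo_solution \<alpha> f x0 x \<longleftrightarrow>
     continuous_on {0..} x \<and>
     (\<forall>t\<ge>0. x t = x0 + riemann_liouville \<alpha> (\<lambda>s. f (x s)) t)"

definition equilibrium_state :: "('a::euclidean_space \<Rightarrow> 'a) \<Rightarrow> 'a \<Rightarrow> bool" where
  "equilibrium_state f xe \<longleftrightarrow> f xe = 0"

(* Both notions below ask explicitly that a solution on all of [0, \<infinity>) exists for each
   nearby initial value, so that they cannot hold vacuously because of blow-up. *)
definition lyapunov_stable ::
  "real \<Rightarrow> ('a::euclidean_space \<Rightarrow> 'a) \<Rightarrow> 'a \<Rightarrow> bool" where
  "lyapunov_stable \<alpha> f xe \<longleftrightarrow>
     (\<forall>\<epsilon>>0. \<exists>\<delta>>0. \<forall>x0. norm (x0 - xe) < \<delta> \<longrightarrow>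
        (\<exists>x. caputo_solution \<alpha> f x0 x) \<and>
        (\<forall>x. caputo_solution \<alpha> f x0 x \<longrightarrow> (\<forall>t\<ge>0. norm (x t - xe) < \<epsilon>)))"

definition locally_attractive ::
  "real \<Rightarrow> ('a::euclidean_space \<Rightarrow> 'a) \<Rightarrow> 'a \<Rightarrow> bool" where
  "locally_attractive \<alpha> f xe \<longleftrightarrow>
     (\<exists>\<delta>>0. \<forall>x0. norm (x0 - xe) < \<delta> \<longrightarrow>
        (\<exists>x. caputo_solution \<alpha> f x0 x) \<and>
        (\<forall>x. caputo_solution \<alpha> f x0 x \<longrightarrow> ((\<lambda>t. norm (x t - xe)) \<longlongrightarrow> 0) at_top))"

definition locally_asymptotically_stable ::
  "real \<Rightarrow> ('a::euclidean_space \<Rightarrow> 'a) \<Rightarrow> 'a \<Rightarrow> bool" where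
  "locally_asymptotically_stable \<alpha> f xe \<longleftrightarrow>
     equilibrium_state f xe \<and> lyapunov_stable \<alpha> f xe \<and> locally_attractive \<alpha> f xe"

definition e2 :: "real \<Rightarrow> real ^ 5" where
  "e2 m = vector [0, 0, 0, 0, m]"

(* Right-hand side of the controlled 5D Maxwell-Bloch system with target state e2 m. *)
definition controlled_maxwell_bloch ::
  "real \<Rightarrow> real \<Rightarrow> real \<Rightarrow> real \<Rightarrow> real \<Rightarrow> real \<Rightarrow> real ^ 5 \<Rightarrow> real ^ 5" where
  "controlled_maxwell_bloch k1 k2 k3 k4 k5 m x = vector
     [x $ 3 - k1 * x $ 1,
      x $ 4 - k2 * x $ 2,
      x $ 1 * x $ 5 - k3 * x $ 3,
      x $ 2 * x $ 5 - k4 * x $ 4,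
      - (x $ 1 * x $ 3 + x $ 2 * x $ 4) - k5 * (x $ 5 - m)]"

end

theory Submission
  imports Defs
begin

text \<open>
  In each of the five cases \<open>m < k1 * k3\<close> and \<open>m < k2 * k4\<close>. These inequalities make
  both linearised \<open>2 \<times> 2\<close> blocks dissipative for a weighted Euclidean norm, and since the cubic terms
  cancel, the full nonlinear field satisfies \<open>y \<bullet> f y \<le> - c * (norm y)\<^sup>2\<close> globally in these coordinates.
  For large \<open>\<mu>\<close> this gives \<open>norm (f y + \<mu> *\<^sub>R y) \<le> (\<mu> - c / 2) * norm y\<close> on bounded sets.

  Let \<open>r\<close> be the resolvent \<open>r + \<mu> k * r = k\<close> of the kernel \<open>k\<close> (\<open>*\<close> is causal convolution). The Volterra
  equation \<open>y = y0 + k * F\<close> is equivalent to \<open>y = (1 - \<mu> \<integral> r) y0 + r * (F + \<mu> y)\<close>. Log-convexity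
  of \<open>k\<close> makes \<open>r\<close> nonnegative, with \<open>\<integral> r\<close> increasing to \<open>1 / \<mu>\<close>, so taking norms in this formula
  gives both \<open>norm (y t) \<le> norm y0\<close> and \<open>y \<longrightarrow> 0\<close> without differentiating a Lyapunov function. The Abel
  kernel is singular at \<open>0\<close>; the resolvent is taken for the continuous kernels \<open>(t + \<epsilon>) powr (\<alpha> - 1)\<close>
  and the error tends to \<open>0\<close> with \<open>\<epsilon>\<close>.
\<close>

section \<open>Causal convolution\<close>

text \<open>In deviations from the equilibrium the linear part splits into the scalar
  \<open>- k5\<close> and two blocks with rows \<open>(- k1, 1)\<close>, \<open>(m, - k3)\<close>
  and \<open>(- k2, 1)\<close>, \<open>(m, - k4)\<close>. Their traces are negative and their
  determinants are \<open>k1 * k3 - m\<close> and \<open>k2 * k4 - m\<close>. The alternatives in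
  the theorem sort the blocks by the sign of the discriminants \<open>(k1 - k3)^2 + 4 * m\<close>
  and \<open>(k2 - k4)^2 + 4 * m\<close>, that is, by real, double or complex eigenvalues.
  Dissipativity is one-sided information on an inner product and does not survive convolution with a
  kernel. Adding a large multiple of \<open>y\<close> turns it into a norm bound with a factor
  \<theta> < \<mu>, and a nonnegative kernel of mass at most 1 / \<mu> gains \<theta> / \<mu> < 1
  from such a bound. For \<alpha> < 1 the resolvent of the Abel kernel is itself singular at 0,
  whereas positivity is proved by looking at a first sign change and a maximum of a continuous
  function. Hence the shifted kernels, whose error is bounded uniformly in time.\<close>

definition conv :: "(real \<Rightarrow> real) \<Rightarrow> (real \<Rightarrow> 'a::euclidean_space) \<Rightarrow> real \<Rightarrow> 'a" where
  "conv k \<phi> t = integral {0..t} (\<lambda>s. k (t - s) *\<^sub>R \<phi> s)"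

lemma conv_cong:
  assumes "\<And>s. 0 \<le> s \<Longrightarrow> s \<le> t \<Longrightarrow> k s = k' s" "\<And>s. 0 \<le> s \<Longrightarrow> s \<le> t \<Longrightarrow> \<phi> s = \<psi> s"
  shows "conv k \<phi> t = conv k' \<psi> t"
  unfolding conv_def using assms by (intro integral_cong) auto

lemma continuous_on_conv_integrand:
  fixes \<phi> :: "real \<Rightarrow> 'a::euclidean_space"
  assumes "continuous_on {0..} k" "continuous_on {0..t} \<phi>"
  shows "continuous_on {0..t} (\<lambda>s. k (t - s) *\<^sub>R \<phi> s)"
proof (rule continuous_on_scaleR[OF _ assms(2)])
  show "continuous_on {0..t} (\<lambda>s. k (t - s))"
    by (rule continuous_on_compose2[OF assms(1)]) (auto intro: continuous_intros)
qed

lemma conv_integrable: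
  fixes \<phi> :: "real \<Rightarrow> 'a::euclidean_space"
  assumes "continuous_on {0..} k" "continuous_on {0..t} \<phi>"
  shows "(\<lambda>s. k (t - s) *\<^sub>R \<phi> s) integrable_on {0..t}"
  by (intro integrable_continuous_interval continuous_on_conv_integrand assms)

lemma conv_add_right:
  fixes \<phi> :: "real \<Rightarrow> 'a::euclidean_space"
  assumes "continuous_on {0..} k" "continuous_on {0..t} \<phi>" "continuous_on {0..t} \<psi>"
  shows "conv k (\<lambda>s. \<phi> s + \<psi> s) t = conv k \<phi> t + conv k \<psi> t"
  unfolding conv_def scaleR_add_right by (intro integral_add conv_integrable assms)

lemma conv_scaleR_right:
  fixes \<phi> :: "real \<Rightarrow> 'a::euclidean_space"
  shows "conv k (\<lambda>s. c *\<^sub>R \<phi> s) t = c *\<^sub>R conv k \<phi> t"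
proof -
  have "(\<lambda>s. k (t - s) *\<^sub>R c *\<^sub>R \<phi> s) = (\<lambda>s. c *\<^sub>R k (t - s) *\<^sub>R \<phi> s)"
    by (simp add: mult.commute)
  then show ?thesis by (simp only: conv_def integral_cmul)
qed

lemma conv_add_left:
  fixes \<phi> :: "real \<Rightarrow> 'a::euclidean_space"
  assumes "continuous_on {0..} k" "continuous_on {0..} l" "continuous_on {0..t} \<phi>"
  shows "conv (\<lambda>s. k s + l s) \<phi> t = conv k \<phi> t + conv l \<phi> t"
  unfolding conv_def scaleR_add_left by (intro integral_add conv_integrable assms)

lemma conv_scaleR_left:
  fixes \<phi> :: "real \<Rightarrow> 'a::euclidean_space"
  shows "conv (\<lambda>s. c * k s) \<phi> t = c *\<^sub>R conv k \<phi> t"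
  unfolding conv_def scaleR_scaleR[symmetric] by (simp only: integral_cmul)

lemma conv_reflect:
  fixes \<phi> :: "real \<Rightarrow> 'a::euclidean_space"
  shows "conv k \<phi> t = integral {0..t} (\<lambda>s. k s *\<^sub>R \<phi> (t - s))"
proof -
  have "integral {0..t} (\<lambda>s. k s *\<^sub>R \<phi> (t - s))
      = integral {0-t..t-t} (\<lambda>s. k (s + t) *\<^sub>R \<phi> (t - (s + t)))"
    by (rule integral_shift_real_ivl[symmetric])
  also have "\<dots> = integral {-t..-0} (\<lambda>s. k (t - - s) *\<^sub>R \<phi> (- s))"
    by (simp add: add.commute)
  also have "\<dots> = integral {0..t} (\<lambda>s. k (t - s) *\<^sub>R \<phi> s)"
    using Henstock_Kurzweil_Integration.integral_reflect_real[of t 0 "\<lambda>s. k (t - s) *\<^sub>R \<phi> s"] by simp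
  finally show ?thesis by (simp add: conv_def)
qed

lemma conv_commute: "conv a b t = conv b a t" for a b :: "real \<Rightarrow> real"
  by (subst conv_reflect) (simp add: conv_def mult.commute)

lemma continuous_on_atLeast:
  fixes f :: "real \<Rightarrow> 'a::topological_space"
  assumes "\<And>T. T \<ge> 0 \<Longrightarrow> continuous_on {0..T} f"
  shows "continuous_on {0..} f"
  unfolding continuous_on_eq_continuous_within
proof
  fix x :: real assume x: "x \<in> {0..}"
  then have "continuous (at x within {0..x+1}) f"
    using assms[of "x+1"] by (auto simp: continuous_on_eq_continuous_within)
  moreover have "at x within {0..x+1} = at x within {0..}"
    by (rule at_within_nhd[of _ "{..<x+1}"]) auto
  ultimately show "continuous (at x within {0..}) f" by simp
qed

lemma continuous_on_conv:
  fixes \<phi> :: "real \<Rightarrow> 'a::euclidean_space"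
  assumes k: "continuous_on {0..} k" and \<phi>: "continuous_on {0..} \<phi>"
  shows "continuous_on {0..} (conv k \<phi>)"
proof -
  have "continuous_on {0..T} (conv k \<phi>)" if "T \<ge> 0" for T
  proof -
    \<comment> \<open>The domain of integration varies with \<open>t\<close>. Extending
      \<open>k\<close> by the constant \<open>k 0\<close> to negative arguments allows integration
      over the fixed interval \<open>{0..T}\<close>, where continuity in a parameter is known; the
      surplus over \<open>{t..T}\<close> is \<open>k 0\<close> times an integral of
      \<open>\<phi>\<close>.\<close>
    define k' where "k' = (\<lambda>s. k (max 0 s))"
    have k': "continuous_on S (\<lambda>x. k' (f x))" if "continuous_on S f" for S and f :: "'b::topological_space \<Rightarrow> real"
      unfolding k'_def by (rule continuous_on_compose2[OF k]) (auto intro!: continuous_intros that)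
    have \<phi>': "continuous_on S (\<lambda>x. \<phi> (f x))" if "continuous_on S f" "f ` S \<subseteq> {0..}"
      for S and f :: "'b::topological_space \<Rightarrow> real"
      by (rule continuous_on_compose2[OF \<phi> that])
    have 1: "continuous_on {0..T} (\<lambda>t. integral (cbox 0 T) (\<lambda>s. k' (t - s) *\<^sub>R \<phi> s))"
      by (rule integral_continuous_on_param) (auto simp: case_prod_beta intro!: continuous_intros k' \<phi>')
    have 2: "continuous_on {0..T} (\<lambda>t. integral {t..T} \<phi>)"
      by (intro indefinite_integral_continuous_1' integrable_continuous_interval continuous_on_subset[OF \<phi>]) auto
    have "conv k \<phi> t = integral (cbox 0 T) (\<lambda>s. k' (t - s) *\<^sub>R \<phi> s) - k 0 *\<^sub>R integral {t..T} \<phi>"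
      if "t \<in> {0..T}" for t
    proof -
      have "(\<lambda>s. k' (t - s) *\<^sub>R \<phi> s) integrable_on {0..T}"
        by (intro integrable_continuous_interval continuous_intros k' continuous_on_subset[OF \<phi>]) auto
      from Henstock_Kurzweil_Integration.integral_combine[OF _ _ this, of t] that
      have "integral {0..T} (\<lambda>s. k' (t - s) *\<^sub>R \<phi> s)
          = integral {0..t} (\<lambda>s. k' (t - s) *\<^sub>R \<phi> s) + integral {t..T} (\<lambda>s. k' (t - s) *\<^sub>R \<phi> s)"
        by simp
      also have "integral {0..t} (\<lambda>s. k' (t - s) *\<^sub>R \<phi> s) = conv k \<phi> t"
        unfolding conv_def by (rule integral_cong) (auto simp: k'_def)
      also have "integral {t..T} (\<lambda>s. k' (t - s) *\<^sub>R \<phi> s) = integral {t..T} (\<lambda>s. k 0 *\<^sub>R \<phi> s)"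
        by (rule integral_cong) (auto simp: k'_def max_def)
      finally show ?thesis by simp
    qed
    note eq = this
    have "continuous_on {0..T} (\<lambda>t. integral (cbox 0 T) (\<lambda>s. k' (t - s) *\<^sub>R \<phi> s) - k 0 *\<^sub>R integral {t..T} \<phi>)"
      by (intro continuous_on_diff continuous_on_scaleR continuous_on_const 1 2)
    then show ?thesis by (rule continuous_on_eq) (simp only: eq)
  qed
  then show ?thesis by (rule continuous_on_atLeast)
qed

text \<open>Fubini for \<open>f\<close> times the indicator of the triangle, which is integrable
  since the triangle is compact. Continuity is asked only there because factors such as
  \<open>b (s - u)\<close> are controlled only for nonnegative arguments.\<close>

lemma integral_swap_triangle:
  fixes f :: "real \<Rightarrow> real \<Rightarrow> 'a::euclidean_space"
  assumes f: "continuous_on {(s, u). 0 \<le> u \<and> u \<le> s \<and> s \<le> t} (\<lambda>(s, u). f s u)"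
  shows "integral {0..t} (\<lambda>s. integral {0..s} (f s)) = integral {0..t} (\<lambda>u. integral {u..t} (\<lambda>s. f s u))"
proof -
  define \<Delta> where "\<Delta> = {(s, u). 0 \<le> u \<and> u \<le> s \<and> s \<le> t}"
  define H where "H = (\<lambda>s u. indicator \<Delta> (s, u) *\<^sub>R f s u)"
  have "closed \<Delta>"
    unfolding \<Delta>_def case_prod_beta
    by (intro closed_Collect_conj closed_Collect_le continuous_on_const continuous_on_fst continuous_on_snd continuous_on_id)
  moreover have "\<Delta> \<subseteq> {0..t} \<times> {0..t}" by (auto simp: \<Delta>_def)
  ultimately have "compact \<Delta>"
    by (metis bounded_subset compact_imp_bounded compact_Times compact_Icc compact_eq_bounded_closed)
  have int: "integrable (lborel \<Otimes>\<^sub>M lborel) (case_prod H)"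
  proof -
    have "integrable lborel (\<lambda>x. indicator \<Delta> x *\<^sub>R (case x of (s, u) \<Rightarrow> f s u))"
      by (rule borel_integrable_compact[OF \<open>compact \<Delta>\<close>]) (use f in \<open>simp only: \<Delta>_def\<close>)
    moreover have "case_prod H = (\<lambda>x. indicator \<Delta> x *\<^sub>R (case x of (s, u) \<Rightarrow> f s u))"
      by (auto simp: H_def fun_eq_iff)
    ultimately show ?thesis by (simp only: lborel_prod)
  qed
  have inner_s: "(\<integral>u. H s u \<partial>lborel) = indicator {0..t} s *\<^sub>R integral {0..s} (f s)" for s
  proof (cases "s \<in> {0..t}")
    case True
    have "continuous_on {0..s} (\<lambda>u. case (s, u) of (s, u) \<Rightarrow> f s u)"
      by (rule continuous_on_compose2[OF f]) (use True in \<open>auto intro: continuous_on_Pair\<close>)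
    then have "continuous_on {0..s} (f s)" by simp
    from set_borel_integral_eq_integral(2)[OF borel_integrable_atLeastAtMost'[OF this]]
    have "(\<integral>u. indicator {0..s} u *\<^sub>R f s u \<partial>lborel) = integral {0..s} (f s)"
      by (simp add: set_lebesgue_integral_def)
    moreover have "H s = (\<lambda>u. indicator {0..s} u *\<^sub>R f s u)"
      using True by (auto simp: H_def \<Delta>_def indicator_def)
    ultimately show ?thesis using True by simp
  next
    case False
    then have "H s = (\<lambda>u. 0)" by (auto simp: H_def \<Delta>_def)
    with False show ?thesis by simp
  qed
  have inner_u: "(\<integral>s. H s u \<partial>lborel) = indicator {0..t} u *\<^sub>R integral {u..t} (\<lambda>s. f s u)" for u
  proof (cases "u \<in> {0..t}")
    case True
    have "continuous_on {u..t} (\<lambda>s. case (s, u) of (s, u) \<Rightarrow> f s u)"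
      by (rule continuous_on_compose2[OF f]) (use True in \<open>auto intro: continuous_on_Pair\<close>)
    then have "continuous_on {u..t} (\<lambda>s. f s u)" by simp
    from set_borel_integral_eq_integral(2)[OF borel_integrable_atLeastAtMost'[OF this]]
    have "(\<integral>s. indicator {u..t} s *\<^sub>R f s u \<partial>lborel) = integral {u..t} (\<lambda>s. f s u)"
      by (simp add: set_lebesgue_integral_def)
    moreover have "(\<lambda>s. H s u) = (\<lambda>s. indicator {u..t} s *\<^sub>R f s u)"
      using True by (auto simp: H_def \<Delta>_def indicator_def)
    ultimately show ?thesis using True by simp
  next
    case False
    then have "(\<lambda>s. H s u) = (\<lambda>s. 0)" by (auto simp: H_def \<Delta>_def)
    with False show ?thesis by simp
  qed
  have eq: "(\<integral>u. (indicator {0..t} u *\<^sub>R integral {u..t} (\<lambda>s. f s u)) \<partial>lborel)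
      = (\<integral>s. (indicator {0..t} s *\<^sub>R integral {0..s} (f s)) \<partial>lborel)"
    using lborel_pair.Fubini_integral[OF int] by (simp add: inner_s inner_u)
  have 1: "set_integrable lborel {0..t} (\<lambda>s. integral {0..s} (f s))"
    using lborel_pair.integrable_fst'[OF int] by (simp add: inner_s set_integrable_def)
  have 2: "set_integrable lborel {0..t} (\<lambda>u. integral {u..t} (\<lambda>s. f s u))"
    using lborel_pair.integrable_snd[OF int] by (simp add: inner_u set_integrable_def)
  show ?thesis
    using eq set_borel_integral_eq_integral(2)[OF 1] set_borel_integral_eq_integral(2)[OF 2]
    by (simp add: set_lebesgue_integral_def)
qed

text \<open>After exchanging the order of integration over the triangle, a shift of \<open>s\<close>
  by \<open>u\<close> turns the inner integral into \<open>conv a b (t - u)\<close>.\<close>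

lemma conv_assoc:
  fixes c :: "real \<Rightarrow> 'a::euclidean_space"
  assumes a: "continuous_on {0..} a" and b: "continuous_on {0..} b" and c: "continuous_on {0..} c"
  shows "conv a (conv b c) t = conv (conv a b) c t"
proof -
  have "conv a (conv b c) t = integral {0..t} (\<lambda>s. integral {0..s} (\<lambda>u. (a (t - s) * b (s - u)) *\<^sub>R c u))"
    unfolding conv_def by (simp only: integral_cmul[symmetric] scaleR_scaleR)
  also have "\<dots> = integral {0..t} (\<lambda>u. integral {u..t} (\<lambda>s. (a (t - s) * b (s - u)) *\<^sub>R c u))"
    by (rule integral_swap_triangle)
      (auto simp: case_prod_beta intro!: continuous_intros continuous_on_compose2[OF a]
        continuous_on_compose2[OF b] continuous_on_compose2[OF c])
  also have "\<dots> = conv (conv a b) c t"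
  proof -
    have "integral {u..t} (\<lambda>s. (a (t - s) * b (s - u)) *\<^sub>R c u) = conv a b (t - u) *\<^sub>R c u" if "u \<in> {0..t}" for u
    proof -
      have cont: "continuous_on {u..t} (\<lambda>s. a (t - s) * b (s - u))"
        by (intro continuous_intros continuous_on_compose2[OF a] continuous_on_compose2[OF b]) auto
      have "integral {u..t} (\<lambda>s. a (t - s) * b (s - u)) = conv a b (t - u)"
        using integral_shift_real_ivl[of u u t "\<lambda>s. a (t - s) * b (s - u)"]
        by (simp add: conv_def algebra_simps)
      moreover have "integral {u..t} (\<lambda>s. (a (t - s) * b (s - u)) *\<^sub>R c u)
          = integral {u..t} (\<lambda>s. a (t - s) * b (s - u)) *\<^sub>R c u"
        using integral_linear[OF integrable_continuous_interval[OF cont] bounded_linear_scaleR_left[of "c u"]]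
        by (simp add: o_def)
      ultimately show ?thesis by simp
    qed
    then show ?thesis unfolding conv_def[of "conv a b"] by (intro integral_cong) auto
  qed
  finally show ?thesis .
qed

section \<open>Resolvents\<close>

definition is_resolvent :: "(real \<Rightarrow> real) \<Rightarrow> real \<Rightarrow> (real \<Rightarrow> real) \<Rightarrow> bool" where
  "is_resolvent k \<mu> r \<longleftrightarrow> continuous_on {0..} r \<and> (\<forall>t\<ge>0. r t + \<mu> * conv k r t = k t)"

text \<open>
  At a first zero \<open>T\<close> of \<open>r\<close>, log-convexity lets the resolvent equation at \<open>T\<close> be compared with the one at
  \<open>u < T\<close>, giving \<open>r u \<le> C * integral {u..T} r\<close>; a maximum of \<open>r\<close> close to \<open>T\<close> contradicts this.
\<close>

lemma resolvent_nonneg: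
  assumes k: "continuous_on {0..} k" "\<And>t. t \<ge> 0 \<Longrightarrow> k t > 0"
    and decr: "\<And>s t. 0 \<le> s \<Longrightarrow> s \<le> t \<Longrightarrow> k t \<le> k s"
    and log_convex: "\<And>s t T. 0 \<le> s \<Longrightarrow> s \<le> t \<Longrightarrow> t \<le> T \<Longrightarrow> k (T - s) * k t \<le> k T * k (t - s)"
    and "\<mu> > 0" and r: "is_resolvent k \<mu> r" and "t \<ge> 0"
  shows "r t \<ge> 0"
proof (rule ccontr)
  assume "\<not> r t \<ge> 0"
  have cr: "continuous_on {0..} r" and eq: "\<And>t. t \<ge> 0 \<Longrightarrow> r t + \<mu> * conv k r t = k t"
    using r by (auto simp: is_resolvent_def)
  have cr': "continuous_on {a..b} r" if "a \<ge> 0" for a b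
    by (rule continuous_on_subset[OF cr]) (use that in auto)
  define S where "S = {0..t} \<inter> r -` {..0}"
  have "closed S"
    unfolding S_def by (intro continuous_closed_preimage cr') auto
  then have "compact S"
    unfolding S_def by (metis bounded_closed_interval bounded_Int compact_eq_bounded_closed)
  moreover have "t \<in> S" using \<open>\<not> r t \<ge> 0\<close> \<open>t \<ge> 0\<close> by (auto simp: S_def)
  ultimately obtain T where T: "T \<in> S" "\<And>s. s \<in> S \<Longrightarrow> T \<le> s"
    using compact_attains_inf[of S] by blast
  have rT: "r T \<le> 0" "T \<ge> 0" "T \<le> t" using T by (auto simp: S_def)
  have pos: "r s > 0" if "0 \<le> s" "s < T" for s
    using T(2)[of s] that rT by (auto simp: S_def not_le[symmetric])
  have "r 0 = k 0" using eq[of 0] by (simp add: conv_def)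
  then have "T \<noteq> 0" using rT k(2)[of 0] by auto
  then have "T > 0" using rT by auto
  \<comment> \<open>\<open>C\<close> collects the factors met in \<open>key\<close>:
    \<open>\<mu> * k 0 / k T\<close> from comparing the two equations and bounding the kernel on
    \<open>{u..T}\<close>, and one more \<open>k 0\<close> from \<open>k u \<le> k 0\<close>, which
    makes the constant independent of \<open>u\<close>.\<close>
  define C where "C = \<mu> * k 0 * k 0 / k T"
  have "C > 0" using k(2)[of 0] k(2)[of T] \<open>\<mu> > 0\<close> rT by (simp add: C_def)
  have kint: "(\<lambda>s. k (u - s) * r s) integrable_on {a..b}" if "0 \<le> a" "b \<le> u" for a b u
    by (intro integrable_continuous_interval continuous_intros continuous_on_compose2[OF k(1)] cr')
      (use that in auto)
  have key: "r u \<le> C * integral {u..T} r" if u: "0 \<le> u" "u < T" for u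
  proof -
    have ku: "k u > 0" "k T > 0" using u k(2)[of u] k(2)[of T] by auto
    have "k T = r T + \<mu> * conv k r T" using eq rT by simp
    also have "conv k r T = integral {0..u} (\<lambda>s. k (T - s) * r s) + integral {u..T} (\<lambda>s. k (T - s) * r s)"
      using u Henstock_Kurzweil_Integration.integral_combine[OF _ _ kint[of 0 T T], of u]
      by (simp add: conv_def)
    finally have 1: "k T \<le> \<mu> * integral {0..u} (\<lambda>s. k (T - s) * r s) + \<mu> * integral {u..T} (\<lambda>s. k (T - s) * r s)"
      using rT by (simp add: algebra_simps)
    have "integral {0..u} (\<lambda>s. k (T - s) * r s) \<le> integral {0..u} (\<lambda>s. k T / k u * (k (u - s) * r s))"
    proof (intro integral_le integrable_on_mult_right kint)
      fix s assume s: "s \<in> {0..u}"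
      \<comment> \<open>Log-convexity: the kernel weights seen from \<open>T\<close> are at most
        \<open>k T / k u\<close> times those seen from \<open>u\<close>. After integration the
        forcing term \<open>k T\<close> cancels against the left-hand side of the equation at
        \<open>T\<close>, so only the integral over \<open>{u..T}\<close> is left to bound
        \<open>r u\<close>.\<close>
      then have "k (T - s) \<le> k T / k u * k (u - s)"
        using log_convex[of s u T] u ku by (simp add: field_simps)
      moreover have "r s \<ge> 0" using pos[of s] s u by simp
      ultimately show "k (T - s) * r s \<le> k T / k u * (k (u - s) * r s)"
        unfolding mult.assoc[symmetric] by (rule mult_right_mono)
    qed (use u in auto)
    also have "\<dots> = k T / k u * conv k r u" by (simp add: conv_def)
    finally have "\<mu> * integral {0..u} (\<lambda>s. k (T - s) * r s) \<le> k T / k u * (\<mu> * conv k r u)"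
      using mult_left_mono[of _ _ \<mu>] \<open>\<mu> > 0\<close> by (fastforce simp: mult_ac)
    also have "\<mu> * conv k r u = k u - r u" using eq[of u] u by simp
    also have "k T / k u * (k u - r u) = k T - k T / k u * r u" using ku by (simp add: field_simps)
    finally have 2: "k T / k u * r u \<le> \<mu> * integral {u..T} (\<lambda>s. k (T - s) * r s)" using 1 by simp
    have pos': "r s \<ge> 0 \<or> s = T" if "s \<in> {u..T}" for s using pos[of s] that u by force
    have "integral {u..T} (\<lambda>s. k (T - s) * r s) \<le> integral {u..T} (\<lambda>s. k 0 * r s)"
    proof (rule integral_le)
      fix s assume s: "s \<in> {u..T}"
      \<comment> \<open>\<open>r T\<close> may be negative, but at \<open>s = T\<close> the kernel
        value is \<open>k 0\<close> and both sides agree.\<close>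
      show "k (T - s) * r s \<le> k 0 * r s"
      proof (cases "s = T")
        case False
        then have "r s \<ge> 0" using pos' s by auto
        then show ?thesis using decr[of 0 "T - s"] s by (intro mult_right_mono) auto
      qed simp
    next
      show "(\<lambda>s. k (T - s) * r s) integrable_on {u..T}" by (rule kint) (use u in auto)
      show "(\<lambda>s. k 0 * r s) integrable_on {u..T}"
        by (intro integrable_on_mult_right integrable_continuous_interval cr' u)
    qed
    then have "integral {u..T} (\<lambda>s. k (T - s) * r s) \<le> k 0 * integral {u..T} r" by simp
    from order_trans[OF 2 mult_left_mono[OF this]]
    have "k T / k u * r u \<le> \<mu> * (k 0 * integral {u..T} r)" using \<open>\<mu> > 0\<close> by simp
    then have 3: "r u \<le> k u * (\<mu> * k 0 / k T * integral {u..T} r)" using ku by (simp add: field_simps)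
    have "0 \<le> k T / k u * r u" using ku pos[of u] u by simp
    also note \<open>k T / k u * r u \<le> \<mu> * (k 0 * integral {u..T} r)\<close>
    finally have "integral {u..T} r \<ge> 0" using \<open>\<mu> > 0\<close> k(2)[of 0] by (simp add: zero_le_mult_iff)
    then have "k u * (\<mu> * k 0 / k T * integral {u..T} r) \<le> k 0 * (\<mu> * k 0 / k T * integral {u..T} r)"
      using decr[of 0 u] u \<open>\<mu> > 0\<close> k(2)[of 0] ku by (intro mult_right_mono) auto
    then show ?thesis using 3 by (simp add: C_def mult_ac)
  qed
  \<comment> \<open>The window has length at most \<open>1 / (2 * C)\<close>, so that at a maximum
    \<open>u\<close> of \<open>r\<close> on it the inequality \<open>key\<close> would give
    \<open>r u \<le> r u / 2\<close> although \<open>r u > 0\<close>.\<close>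
  define t0 where "t0 = max 0 (T - 1 / (2 * C))"
  have t0: "0 \<le> t0" "t0 < T" "C * (T - t0) \<le> 1 / 2"
    using \<open>T > 0\<close> \<open>C > 0\<close> by (auto simp: t0_def max_def field_simps)
  obtain u where u: "u \<in> {t0..T}" "\<And>s. s \<in> {t0..T} \<Longrightarrow> r s \<le> r u"
    using continuous_attains_sup[OF compact_Icc _ cr'[OF t0(1)], of T] t0 by auto
  have ru: "r u > 0" using u(2)[of t0] pos[of t0] t0 by auto
  then have "u < T" using u(1) rT by (cases "u = T") auto
  have "integral {u..T} r \<le> integral {u..T} (\<lambda>_. r u)"
    by (rule integral_le) (use u t0 in \<open>auto intro!: integrable_continuous_interval cr'\<close>)
  also have "\<dots> = (T - u) * r u" using \<open>u < T\<close> by simp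
  finally have "C * integral {u..T} r \<le> (C * (T - u)) * r u" using \<open>C > 0\<close> by simp
  also have "\<dots> \<le> (1 / 2) * r u"
  proof (rule mult_right_mono)
    have "C * (T - u) \<le> C * (T - t0)" using u(1) \<open>C > 0\<close> by simp
    with t0 show "C * (T - u) \<le> 1 / 2" by simp
  qed (use ru in simp)
  also have "\<dots> < r u" using ru by simp
  finally show False using key[of u] \<open>u < T\<close> u(1) t0 by simp
qed

text \<open>A decreasing kernel satisfies \<open>k (t - s) \<ge> k t\<close>, so \<open>k t\<close>
  times the mass of \<open>r\<close> is at most \<open>conv k r t\<close>; dropping
  \<open>r t \<ge> 0\<close> in the resolvent equation bounds \<mu> times this by
  \<open>k t\<close>.\<close>

lemma resolvent_integral_le:
  assumes k: "continuous_on {0..} k" "\<And>t. t \<ge> 0 \<Longrightarrow> k t > 0"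
    and decr: "\<And>s t. 0 \<le> s \<Longrightarrow> s \<le> t \<Longrightarrow> k t \<le> k s"
    and r: "is_resolvent k \<mu> r" and nonneg: "\<And>t. t \<ge> 0 \<Longrightarrow> r t \<ge> 0" and "\<mu> > 0" "t \<ge> 0"
  shows "\<mu> * integral {0..t} r \<le> 1"
proof -
  have cr: "continuous_on {0..t} r" and eq: "r t + \<mu> * conv k r t = k t"
    using r \<open>t \<ge> 0\<close> by (auto simp: is_resolvent_def intro: continuous_on_subset)
  have "k t * integral {0..t} r = integral {0..t} (\<lambda>s. k t * r s)" by simp
  also have "\<dots> \<le> integral {0..t} (\<lambda>s. k (t - s) * r s)"
  proof (rule integral_le)
    show "(\<lambda>s. k t * r s) integrable_on {0..t}"
      by (intro integrable_on_mult_right integrable_continuous_interval cr)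
    show "(\<lambda>s. k (t - s) * r s) integrable_on {0..t}" using conv_integrable[OF k(1) cr] by simp
  qed (auto intro!: mult_right_mono decr nonneg)
  also have "\<dots> = conv k r t" by (simp add: conv_def)
  finally have "\<mu> * (k t * integral {0..t} r) \<le> \<mu> * conv k r t" using \<open>\<mu> > 0\<close> by simp
  also have "\<dots> \<le> k t" using eq nonneg[of t] \<open>t \<ge> 0\<close> by simp
  finally have "k t * (\<mu> * integral {0..t} r) \<le> k t * 1" by (simp add: mult_ac)
  then show ?thesis using k(2)[OF \<open>t \<ge> 0\<close>] by (simp only: mult_le_cancel_left_pos)
qed

text \<open>Integrating the resolvent equation gives \<open>K = R + \<mu> * conv K r\<close> for the
  primitives \<open>K\<close>, \<open>R\<close> of \<open>k\<close>, \<open>r\<close>. As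
  \<open>K\<close> increases, \<open>conv K r t \<le> K t * R t\<close>, and the claim is a
  rearrangement. It quantifies how the mass of \<open>r\<close> approaches \<open>1 / \<mu>\<close>
  when \<open>k\<close> has infinite mass.\<close>

lemma resolvent_integral_ge:
  assumes k: "continuous_on {0..} k" "\<And>t. t \<ge> 0 \<Longrightarrow> k t > 0"
    and r: "is_resolvent k \<mu> r" and nonneg: "\<And>t. t \<ge> 0 \<Longrightarrow> r t \<ge> 0" and "\<mu> > 0" "t \<ge> 0"
  shows "(1 - \<mu> * integral {0..t} r) * (1 + \<mu> * integral {0..t} k) \<le> 1"
proof -
  have cr: "continuous_on {0..} r" and eq: "\<And>t. t \<ge> 0 \<Longrightarrow> r t + \<mu> * conv k r t = k t"
    using r by (auto simp: is_resolvent_def)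
  have cr': "continuous_on {0..t} r" for t by (rule continuous_on_subset[OF cr]) auto
  have ck': "continuous_on {0..t} k" for t by (rule continuous_on_subset[OF k(1)]) auto
  have one: "conv (\<lambda>_. 1) f t = integral {0..t} f" for f :: "real \<Rightarrow> real" and t by (simp add: conv_def)
  have cK: "continuous_on {0..} (conv (\<lambda>_. 1) k)" by (intro continuous_on_conv k continuous_intros)
  have "integral {0..t} k = conv (\<lambda>_. 1) (\<lambda>s. r s + \<mu> *\<^sub>R conv k r s) t"
    by (simp add: one) (intro integral_cong, use eq in auto)
  also have "\<dots> = integral {0..t} r + \<mu> * conv (\<lambda>_. 1) (conv k r) t"
    by (subst conv_add_right)
      (auto simp: one conv_scaleR_right intro!: continuous_intros cr' continuous_on_subset[OF continuous_on_conv[OF k(1) cr]])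
  also have "conv (\<lambda>_. 1) (conv k r) t = conv (conv (\<lambda>_. 1) k) r t"
    by (intro conv_assoc k cr continuous_intros)
  finally have 1: "integral {0..t} k = integral {0..t} r + \<mu> * conv (conv (\<lambda>_. 1) k) r t" .
  have "conv (conv (\<lambda>_. 1) k) r t \<le> integral {0..t} (\<lambda>s. integral {0..t} k * r s)"
    unfolding conv_def[of _ r] real_scaleR_def
  proof (rule integral_le)
    show "(\<lambda>s. conv (\<lambda>_. 1) k (t - s) * r s) integrable_on {0..t}"
      using conv_integrable[OF cK cr'] by simp
    show "(\<lambda>s. integral {0..t} k * r s) integrable_on {0..t}"
      by (intro integrable_on_mult_right integrable_continuous_interval cr')
    fix s assume s: "s \<in> {0..t}"
    show "conv (\<lambda>_. 1) k (t - s) * r s \<le> integral {0..t} k * r s"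
      unfolding one using s k(2)
      by (intro mult_right_mono nonneg integral_subset_le integrable_continuous_interval ck')
        (auto intro: less_imp_le)
  qed
  also have "\<dots> = integral {0..t} k * integral {0..t} r" by simp
  finally have "\<mu> * conv (conv (\<lambda>_. 1) k) r t \<le> \<mu> * (integral {0..t} k * integral {0..t} r)"
    using \<open>\<mu> > 0\<close> by simp
  with 1 have "integral {0..t} k \<le> integral {0..t} r + \<mu> * (integral {0..t} k * integral {0..t} r)" by simp
  then have "\<mu> * integral {0..t} k \<le> \<mu> * (integral {0..t} r + \<mu> * (integral {0..t} k * integral {0..t} r))"
    using \<open>\<mu> > 0\<close> by simp
  then show ?thesis by (simp add: algebra_simps)
qed

text \<open>Convolving the equation with \<open>r\<close> and using associativity turns
  \<open>conv r q\<close> into the convolution of \<open>r + \<mu> * conv k r\<close>, which is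
  \<open>k\<close>, with \<open>y\<close>. Inserting this into the equation isolates
  \<open>y\<close>.\<close>

lemma resolvent_solution:
  fixes y :: "real \<Rightarrow> 'a::euclidean_space"
  assumes k: "continuous_on {0..} k" and r: "is_resolvent k \<mu> r"
    and y: "continuous_on {0..} y" and q: "continuous_on {0..} q"
    and eq: "\<And>t. t \<ge> 0 \<Longrightarrow> y t + \<mu> *\<^sub>R conv k y t = q t" and "t \<ge> 0"
  shows "y t = q t - \<mu> *\<^sub>R conv r q t"
proof -
  have cr: "continuous_on {0..} r" and req: "\<And>t. t \<ge> 0 \<Longrightarrow> r t + \<mu> * conv k r t = k t"
    using r by (auto simp: is_resolvent_def)
  have sub: "continuous_on {0..t} f" if "continuous_on {0..} f" for f :: "real \<Rightarrow> 'b::topological_space"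
    by (rule continuous_on_subset[OF that]) auto
  note c = continuous_on_conv[OF k y] continuous_on_conv[OF k cr]
  have "conv r q t = conv r (\<lambda>s. y s + \<mu> *\<^sub>R conv k y s) t" by (rule conv_cong) (auto simp: eq)
  also have "\<dots> = conv r y t + \<mu> *\<^sub>R conv r (conv k y) t"
    by (subst conv_add_right) (auto simp: conv_scaleR_right intro!: cr sub y c continuous_intros)
  also have "conv r (conv k y) t = conv (conv k r) y t"
    by (simp add: conv_assoc cr k y conv_commute[of r k, abs_def] flip: fun_eq_iff)
  also have "conv r y t + \<mu> *\<^sub>R conv (conv k r) y t = conv (\<lambda>s. r s + \<mu> * conv k r s) y t"
    by (subst conv_add_left) (auto simp: conv_scaleR_left intro!: cr sub y c continuous_intros)
  also have "\<dots> = conv k y t" by (rule conv_cong) (auto simp: req)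
  finally show ?thesis using eq[OF \<open>t \<ge> 0\<close>] by (simp add: algebra_simps)
qed

section \<open>Weakly singular Volterra equations\<close>

lemma has_integral_reflect_0:
  fixes f :: "real \<Rightarrow> 'a::real_normed_vector"
  assumes "(f has_integral i) {0..t}"
  shows "((\<lambda>s. f (t - s)) has_integral i) {0..t}"
proof -
  have "((\<lambda>x. f (- 1 *\<^sub>R x + t)) has_integral i) ((\<lambda>x. t - x) ` {0..t})"
    using has_integral_affinity[of f i 0 t "-1" t] assms by simp
  then show ?thesis by (simp add: add.commute)
qed

text \<open>A singular kernel makes the integrand discontinuous, so integrability comes from a
  bounded measurable function times an absolutely integrable one.\<close>

lemma conv_singular_integrable:
  fixes \<phi> :: "real \<Rightarrow> 'a::euclidean_space"
  assumes k: "k absolutely_integrable_on {0..t}" and \<phi>: "continuous_on {0..t} \<phi>"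
  shows "(\<lambda>s. k (t - s) *\<^sub>R \<phi> s) integrable_on {0..t}"
proof -
  have 1: "(\<lambda>s. k (t - s)) absolutely_integrable_on {0..t}"
    using k has_integral_reflect_0[of k] has_integral_reflect_0[of "\<lambda>s. norm (k s)"]
    unfolding absolutely_integrable_on_def integrable_on_def by blast
  have 2: "bounded (\<phi> ` {0..t})"
    by (intro compact_imp_bounded compact_continuous_image \<phi>) auto
  have 3: "\<phi> \<in> borel_measurable (lebesgue_on {0..t})"
    by (rule continuous_imp_measurable_on_sets_lebesgue[OF \<phi>]) auto
  have 4: "bilinear (\<lambda>(x :: 'a) (y :: real). y *\<^sub>R x)"
    unfolding bilinear_conv_bounded_bilinear by (rule bounded_bilinear.flip[OF bounded_bilinear_scaleR])
  from absolutely_integrable_bounded_measurable_product[OF 4 3 _ 2 1]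
  show ?thesis by (simp add: set_lebesgue_integral_eq_integral(1))
qed

text \<open>Young's inequality between \<open>L^1\<close> and \<open>L^infinity\<close>; the
  estimates for replacing one kernel by another rest on it.\<close>

lemma norm_conv_le:
  fixes \<phi> :: "real \<Rightarrow> 'a::euclidean_space"
  assumes k: "k absolutely_integrable_on {0..t}" and \<phi>: "continuous_on {0..t} \<phi>"
    and C: "\<And>s. s \<in> {0..t} \<Longrightarrow> norm (\<phi> s) \<le> C"
  shows "norm (conv k \<phi> t) \<le> C * integral {0..t} (\<lambda>s. \<bar>k s\<bar>)"
proof -
  have "((\<lambda>s. \<bar>k s\<bar>) has_integral integral {0..t} (\<lambda>s. \<bar>k s\<bar>)) {0..t}"
    using k by (intro integrable_integral) (simp add: absolutely_integrable_on_def)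
  from has_integral_mult_right[OF has_integral_reflect_0[OF this], of C]
  have *: "((\<lambda>s. C * \<bar>k (t - s)\<bar>) has_integral C * integral {0..t} (\<lambda>s. \<bar>k s\<bar>)) {0..t}" .
  have "norm (conv k \<phi> t) \<le> integral {0..t} (\<lambda>s. C * \<bar>k (t - s)\<bar>)"
    unfolding conv_def
  proof (rule integral_norm_bound_integral[OF conv_singular_integrable[OF k \<phi>]])
    show "(\<lambda>s. C * \<bar>k (t - s)\<bar>) integrable_on {0..t}" using * by blast
    fix s assume "s \<in> {0..t}"
    from mult_left_mono[OF C[OF this], of "\<bar>k (t - s)\<bar>"]
    show "norm (k (t - s) *\<^sub>R \<phi> s) \<le> C * \<bar>k (t - s)\<bar>" by (simp add: mult.commute)
  qed
  also have "\<dots> = C * integral {0..t} (\<lambda>s. \<bar>k s\<bar>)" using * by (rule integral_unique)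
  finally show ?thesis .
qed

text \<open>The bound is uniform in \<open>t\<close>, that is, \<open>k\<close> is approximated in \<open>L\<^sup>1\<close> on the whole half-line.\<close>

definition weakly_singular :: "(real \<Rightarrow> real) \<Rightarrow> bool" where
  "weakly_singular k \<longleftrightarrow> (\<forall>\<eta>>0. \<exists>l K. continuous_on {0..} l \<and> (\<forall>t\<ge>0. \<bar>l t\<bar> \<le> K) \<and>
     (\<forall>t\<ge>0. (\<lambda>s. k s - l s) absolutely_integrable_on {0..t} \<and> integral {0..t} (\<lambda>s. \<bar>k s - l s\<bar>) \<le> \<eta>))"

lemma absolutely_integrable_continuous_atLeast:
  fixes l :: "real \<Rightarrow> real"
  assumes "continuous_on {0..} l"
  shows "l absolutely_integrable_on {0..t}"
  using absolutely_integrable_continuous_real[of 0 t l] continuous_on_subset[OF assms, of "{0..t}"]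
  by auto

lemma weakly_singular_integrable:
  assumes "weakly_singular k" "t \<ge> 0"
  shows "k absolutely_integrable_on {0..t}"
proof -
  obtain l where l: "continuous_on {0..} l" "(\<lambda>s. k s - l s) absolutely_integrable_on {0..t}"
    using assms unfolding weakly_singular_def by (meson zero_less_one)
  from set_integral_add(1)[OF l(2) absolutely_integrable_continuous_atLeast[OF l(1)]]
  show ?thesis by simp
qed

lemma conv_diff_left:
  fixes \<phi> :: "real \<Rightarrow> 'a::euclidean_space"
  assumes "k absolutely_integrable_on {0..t}" "l absolutely_integrable_on {0..t}" "continuous_on {0..t} \<phi>"
  shows "conv (\<lambda>s. k s - l s) \<phi> t = conv k \<phi> t - conv l \<phi> t"
  unfolding conv_def scaleR_diff_left by (intro integral_diff conv_singular_integrable assms)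

text \<open>By \<open>norm_conv_le\<close> the convolutions with continuous approximants
  \<open>l n\<close> converge uniformly on each \<open>{0..T}\<close>, so continuity passes to the
  limit.\<close>

lemma continuous_on_conv_weakly_singular:
  fixes \<phi> :: "real \<Rightarrow> 'a::euclidean_space"
  assumes k: "weakly_singular k" and \<phi>: "continuous_on {0..} \<phi>"
  shows "continuous_on {0..} (conv k \<phi>)"
proof (rule continuous_on_atLeast)
  fix T :: real assume "T \<ge> 0"
  have \<phi>': "continuous_on {0..t} \<phi>" for t by (rule continuous_on_subset[OF \<phi>]) auto
  have "bounded (\<phi> ` {0..T})"
    by (intro compact_imp_bounded compact_continuous_image \<phi>') auto
  then obtain C where C: "C > 0" "\<And>s. s \<in> {0..T} \<Longrightarrow> norm (\<phi> s) \<le> C"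
    unfolding bounded_pos by auto
  have "\<exists>l. continuous_on {0..} l \<and> (\<forall>t\<ge>0. (\<lambda>s. k s - l s) absolutely_integrable_on {0..t} \<and>
      integral {0..t} (\<lambda>s. \<bar>k s - l s\<bar>) \<le> inverse (real (Suc n)))" for n
  proof -
    have "inverse (real (Suc n)) > 0" by simp
    from k[unfolded weakly_singular_def, rule_format, OF this] show ?thesis by blast
  qed
  then obtain l where l: "\<And>n. continuous_on {0..} (l n)"
      "\<And>n t. t \<ge> 0 \<Longrightarrow> (\<lambda>s. k s - l n s) absolutely_integrable_on {0..t}"
      "\<And>n t. t \<ge> 0 \<Longrightarrow> integral {0..t} (\<lambda>s. \<bar>k s - l n s\<bar>) \<le> inverse (real (Suc n))"
    by metis
  have est: "dist (conv (l n) \<phi> t) (conv k \<phi> t) \<le> C * inverse (real (Suc n))" if t: "t \<in> {0..T}" for n t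
  proof -
    have "norm (conv (\<lambda>s. k s - l n s) \<phi> t) \<le> C * integral {0..t} (\<lambda>s. \<bar>k s - l n s\<bar>)"
      by (rule norm_conv_le[OF l(2) \<phi>' C(2)]) (use t in auto)
    also have "\<dots> \<le> C * inverse (real (Suc n))" using l(3)[of t n] t C by (intro mult_left_mono) auto
    also have "conv (\<lambda>s. k s - l n s) \<phi> t = conv k \<phi> t - conv (l n) \<phi> t"
      using t by (intro conv_diff_left weakly_singular_integrable[OF k]
        absolutely_integrable_continuous_atLeast l \<phi>') auto
    finally show ?thesis by (simp add: dist_norm norm_minus_commute)
  qed
  show "continuous_on {0..T} (conv k \<phi>)"
  proof (rule uniform_limit_theorem)
    show "\<forall>\<^sub>F n in sequentially. continuous_on {0..T} (conv (l n) \<phi>)"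
      by (intro always_eventually allI continuous_on_subset[OF continuous_on_conv[OF l(1) \<phi>]]) auto
    show "uniform_limit {0..T} (\<lambda>n. conv (l n) \<phi>) (conv k \<phi>) sequentially"
    proof (rule uniform_limitI)
      fix e :: real assume "e > 0"
      have "(\<lambda>n. C * inverse (real (Suc n))) \<longlonglongrightarrow> C * 0"
        by (intro tendsto_intros LIMSEQ_inverse_real_of_nat)
      then have "\<forall>\<^sub>F n in sequentially. C * inverse (real (Suc n)) < e"
        using \<open>e > 0\<close> by (intro order_tendstoD(2)) auto
      then show "\<forall>\<^sub>F n in sequentially. \<forall>t\<in>{0..T}. dist (conv (l n) \<phi> t) (conv k \<phi> t) < e"
        by eventually_elim (intro ballI le_less_trans[OF est])
    qed
  qed simp
qed

text \<open>In the supremum norm weighted by \<open>exp (- \<omega> * t)\<close>, convolution with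
  \<open>k\<close> has norm at most \<theta> once \<omega> is large: the part of \<open>k\<close>
  that is small in \<open>L^1\<close> contributes \<open>\<theta> / 2\<close>, and the bounded part
  \<open>l\<close> contributes \<open>K / \<omega>\<close>, the factor gained by integrating the
  exponential.\<close>

lemma weakly_singular_exp_bound:
  assumes k: "weakly_singular k" and "\<theta> > 0"
  obtains \<omega> where "\<omega> > 0"
    "\<And>(\<phi> :: real \<Rightarrow> 'a::euclidean_space) C t. continuous_on {0..t} \<phi> \<Longrightarrow> t \<ge> 0 \<Longrightarrow>
      (\<And>s. 0 \<le> s \<Longrightarrow> s \<le> t \<Longrightarrow> norm (\<phi> s) \<le> C * exp (\<omega> * s)) \<Longrightarrow> norm (conv k \<phi> t) \<le> \<theta> * C * exp (\<omega> * t)"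
proof -
  obtain l K where l: "continuous_on {0..} l" "\<And>t. t \<ge> 0 \<Longrightarrow> \<bar>l t\<bar> \<le> K"
      "\<And>t. t \<ge> 0 \<Longrightarrow> (\<lambda>s. k s - l s) absolutely_integrable_on {0..t}"
      "\<And>t. t \<ge> 0 \<Longrightarrow> integral {0..t} (\<lambda>s. \<bar>k s - l s\<bar>) \<le> \<theta> / 2"
    using k[unfolded weakly_singular_def, rule_format, of "\<theta> / 2"] \<open>\<theta> > 0\<close> by auto
  have "K \<ge> 0" using l(2)[of 0] by simp
  define \<omega> where "\<omega> = 2 * (K + 1) / \<theta>"
  have "\<omega> > 0" using \<open>K \<ge> 0\<close> \<open>\<theta> > 0\<close> by (simp add: \<omega>_def)
  have "K / \<omega> \<le> \<theta> / 2" using \<open>K \<ge> 0\<close> \<open>\<theta> > 0\<close> by (simp add: \<omega>_def field_simps)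
  show thesis
  proof (rule that[OF \<open>\<omega> > 0\<close>])
    fix \<phi> :: "real \<Rightarrow> 'a" and C t
    assume \<phi>: "continuous_on {0..t} \<phi>" and t: "t \<ge> 0"
      and C: "\<And>s. 0 \<le> s \<Longrightarrow> s \<le> t \<Longrightarrow> norm (\<phi> s) \<le> C * exp (\<omega> * s)"
    have "0 \<le> C" using order_trans[OF norm_ge_zero C[of 0]] t by simp
    have "((\<lambda>s. K * C * exp (\<omega> * s)) has_integral K * C / \<omega> * exp (\<omega> * t) - K * C / \<omega> * exp (\<omega> * 0)) {0..t}"
      using \<open>\<omega> > 0\<close> t
      by (intro fundamental_theorem_of_calculus)
        (auto intro!: derivative_eq_intros simp flip: has_real_derivative_iff_has_vector_derivative)
    note int = this
    have "norm (conv l \<phi> t) \<le> integral {0..t} (\<lambda>s. K * C * exp (\<omega> * s))"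
      unfolding conv_def
    proof (rule integral_norm_bound_integral[OF conv_integrable[OF l(1) \<phi>]])
      show "(\<lambda>s. K * C * exp (\<omega> * s)) integrable_on {0..t}" using int by blast
      fix s assume "s \<in> {0..t}"
      then have "\<bar>l (t - s)\<bar> * norm (\<phi> s) \<le> K * (C * exp (\<omega> * s))"
        using l(2)[of "t - s"] C[of s] \<open>K \<ge> 0\<close> by (intro mult_mono) auto
      then show "norm (l (t - s) *\<^sub>R \<phi> s) \<le> K * C * exp (\<omega> * s)" by (simp add: mult.assoc)
    qed
    also have "\<dots> = K / \<omega> * (C * exp (\<omega> * t)) - K * C / \<omega>"
      using integral_unique[OF int] by (simp add: mult.assoc)
    also have "\<dots> \<le> K / \<omega> * (C * exp (\<omega> * t))" using \<open>K \<ge> 0\<close> \<open>C \<ge> 0\<close> \<open>\<omega> > 0\<close> by simp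
    also have "\<dots> \<le> \<theta> / 2 * (C * exp (\<omega> * t))"
      by (intro mult_right_mono) (use \<open>K / \<omega> \<le> \<theta> / 2\<close> \<open>C \<ge> 0\<close> in auto)
    finally have 1: "norm (conv l \<phi> t) \<le> \<theta> / 2 * (C * exp (\<omega> * t))" .
    have "norm (conv (\<lambda>s. k s - l s) \<phi> t) \<le> (C * exp (\<omega> * t)) * integral {0..t} (\<lambda>s. \<bar>k s - l s\<bar>)"
    proof (rule norm_conv_le[OF l(3)[OF t] \<phi>])
      fix s assume s: "s \<in> {0..t}"
      then have "C * exp (\<omega> * s) \<le> C * exp (\<omega> * t)" using \<open>C \<ge> 0\<close> \<open>\<omega> > 0\<close> by (intro mult_left_mono) auto
      with C[of s] s show "norm (\<phi> s) \<le> C * exp (\<omega> * t)" by auto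
    qed
    also have "\<dots> \<le> (C * exp (\<omega> * t)) * (\<theta> / 2)"
      using l(4)[OF t] \<open>C \<ge> 0\<close> by (intro mult_left_mono) auto
    also have "conv (\<lambda>s. k s - l s) \<phi> t = conv k \<phi> t - conv l \<phi> t"
      using t by (intro conv_diff_left weakly_singular_integrable[OF k]
        absolutely_integrable_continuous_atLeast l \<phi>) auto
    finally have 2: "norm (conv k \<phi> t - conv l \<phi> t) \<le> \<theta> / 2 * (C * exp (\<omega> * t))" by (simp add: mult_ac)
    have "norm (conv k \<phi> t) \<le> norm (conv k \<phi> t - conv l \<phi> t) + norm (conv l \<phi> t)"
      using norm_triangle_ineq[of "conv k \<phi> t - conv l \<phi> t" "conv l \<phi> t"] by simp
    with 1 2 show "norm (conv k \<phi> t) \<le> \<theta> * C * exp (\<omega> * t)" by simp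
  qed
qed

text \<open>Banach's fixed point theorem for the rescaled unknown \<open>exp (- \<omega> * t) *\<^sub>R x t\<close>.\<close>

lemma volterra_solution_exists:
  fixes f :: "'a::euclidean_space \<Rightarrow> 'a"
  assumes k: "weakly_singular k" and f: "L-lipschitz_on UNIV f"
    and q: "continuous_on {0..} q" "\<And>t. t \<ge> 0 \<Longrightarrow> norm (q t) \<le> Q"
  obtains x where "continuous_on {0..} x" "\<And>t. t \<ge> 0 \<Longrightarrow> x t = q t + conv k (\<lambda>s. f (x s)) t"
proof -
  have "L \<ge> 0" using f by (rule lipschitz_on_nonneg)
  define \<theta> where "\<theta> = 1 / (2 * (L + 1))"
  have \<theta>: "\<theta> > 0" "\<theta> * L \<le> 1 / 2" using \<open>L \<ge> 0\<close> by (auto simp: \<theta>_def field_simps)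
  obtain \<omega> where \<omega>: "\<omega> > 0" "\<And>(\<phi> :: real \<Rightarrow> 'a) C t. continuous_on {0..t} \<phi> \<Longrightarrow> t \<ge> 0 \<Longrightarrow>
      (\<And>s. 0 \<le> s \<Longrightarrow> s \<le> t \<Longrightarrow> norm (\<phi> s) \<le> C * exp (\<omega> * s)) \<Longrightarrow> norm (conv k \<phi> t) \<le> \<theta> * C * exp (\<omega> * t)"
    using weakly_singular_exp_bound[OF k \<theta>(1)] by metis
  \<comment> \<open>\<open>X z\<close> undoes the rescaling of the bounded function
    \<open>z\<close>, and \<open>P z\<close> is the rescaled right-hand side of the equation
    evaluated at \<open>X z\<close>.\<close>
  define X where "X = (\<lambda>(z :: real \<Rightarrow>\<^sub>C 'a) s. exp (\<omega> * s) *\<^sub>R z s)"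
  define P where "P = (\<lambda>z t. exp (- \<omega> * t) *\<^sub>R (q t + conv k (\<lambda>s. f (X z s)) t))"
  have fc: "continuous_on S f" for S
    using lipschitz_on_continuous_on[OF f] continuous_on_subset by blast
  have cont: "continuous_on S (\<lambda>s. f (X z s))" for S z
    unfolding X_def
    by (rule continuous_on_compose2[OF fc[of UNIV]])
      (intro continuous_on_scaleR continuous_intros continuous_on_apply_bcontfun, simp)
  have contP: "continuous_on {0..} (P z)" for z
    unfolding P_def by (intro continuous_intros q continuous_on_conv_weakly_singular[OF k] cont)
  have f_le: "norm (f x - f y) \<le> L * norm (x - y)" for x y
    using lipschitz_onD[OF f, of x y] by (simp add: dist_norm)
  have exp_cancel: "exp (- \<omega> * t) * (a * exp (\<omega> * t)) = a" for a t
    by (simp add: exp_minus)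
  have bound: "norm (P z t) \<le> Q + \<theta> * (norm (f 0) + L * norm z)" if "t \<ge> 0" for z t
  proof -
    have "norm (conv k (\<lambda>s. f (X z s)) t) \<le> \<theta> * (norm (f 0) + L * norm z) * exp (\<omega> * t)"
    proof (rule \<omega>(2)[OF cont that])
      fix s :: real assume "0 \<le> s" "s \<le> t"
      have "norm (X z s) \<le> norm z * exp (\<omega> * s)"
        using norm_bounded[of z s] by (simp add: X_def mult.commute)
      from mult_left_mono[OF this \<open>L \<ge> 0\<close>]
      have "norm (f (X z s)) \<le> norm (f 0) + L * norm z * exp (\<omega> * s)"
        using f_le[of "X z s" 0] norm_triangle_ineq2[of "f (X z s)" "f 0"] by (simp add: mult.assoc)
      also have "norm (f 0) \<le> norm (f 0) * exp (\<omega> * s)"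
        using \<open>0 \<le> s\<close> \<omega>(1) by (simp add: mult_le_cancel_left1)
      finally show "norm (f (X z s)) \<le> (norm (f 0) + L * norm z) * exp (\<omega> * s)"
        by (simp add: algebra_simps)
    qed
    then have "exp (- \<omega> * t) * norm (conv k (\<lambda>s. f (X z s)) t)
        \<le> exp (- \<omega> * t) * (\<theta> * (norm (f 0) + L * norm z) * exp (\<omega> * t))"
      by (intro mult_left_mono) auto
    also have "\<dots> = \<theta> * (norm (f 0) + L * norm z)" by (rule exp_cancel)
    finally have 1: "exp (- \<omega> * t) * norm (conv k (\<lambda>s. f (X z s)) t) \<le> \<theta> * (norm (f 0) + L * norm z)" .
    have "exp (- \<omega> * t) * norm (q t) \<le> 1 * Q"
      using q(2)[OF that] that \<omega>(1) by (intro mult_mono) auto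
    moreover have "norm (P z t) \<le> exp (- \<omega> * t) * (norm (q t) + norm (conv k (\<lambda>s. f (X z s)) t))"
      unfolding P_def by (simp add: norm_triangle_ineq)
    ultimately show ?thesis using 1 by (simp add: distrib_left)
  qed
  \<comment> \<open>Elements of the function space live on the whole line, so \<open>P z\<close> is
    continued to negative times by its value at 0; a fixed point still solves the equation for
    \<open>t \<ge> 0\<close>.\<close>
  define \<Psi> where "\<Psi> = (\<lambda>z. Bcontfun (\<lambda>t. P z (max 0 t)))"
  have \<Psi>: "apply_bcontfun (\<Psi> z) t = P z (max 0 t)" for z t
    unfolding \<Psi>_def
  proof (subst Bcontfun_inverse)
    have "continuous_on UNIV (\<lambda>t. P z (max 0 t))"
      by (rule continuous_on_compose2[OF contP]) (auto intro: continuous_on_max continuous_on_const continuous_on_id)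
    then show "(\<lambda>t. P z (max 0 t)) \<in> bcontfun" by (rule bcontfun_normI) (rule bound, simp)
  qed simp
  have "\<exists>!z. \<Psi> z = z"
  proof (rule banach_fix_type)
    show "0 \<le> (1 / 2 :: real)" "(1 / 2 :: real) < 1" by auto
    show "\<forall>y z. dist (\<Psi> y) (\<Psi> z) \<le> 1 / 2 * dist y z"
    proof (intro allI dist_bound)
      fix y z :: "real \<Rightarrow>\<^sub>C 'a" and t' :: real
      define t where "t = max 0 t'"
      have t: "t \<ge> 0" by (simp add: t_def)
      have "norm (conv k (\<lambda>s. f (X y s) - f (X z s)) t) \<le> \<theta> * (L * dist y z) * exp (\<omega> * t)"
      proof (rule \<omega>(2)[OF _ t])
        fix s :: real
        have "norm (f (X y s) - f (X z s)) \<le> L * norm (X y s - X z s)" by (rule f_le)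
        also have "norm (X y s - X z s) = exp (\<omega> * s) * dist (y s) (z s)"
          by (simp add: X_def dist_norm flip: scaleR_diff_right)
        also have "L * \<dots> \<le> L * (exp (\<omega> * s) * dist y z)"
          using \<open>L \<ge> 0\<close> by (intro mult_left_mono dist_bounded) auto
        finally show "norm (f (X y s) - f (X z s)) \<le> L * dist y z * exp (\<omega> * s)" by (simp add: mult_ac)
      qed (intro continuous_on_diff cont)
      also have "\<theta> * (L * dist y z) * exp (\<omega> * t) \<le> 1 / 2 * dist y z * exp (\<omega> * t)"
        using mult_right_mono[OF \<theta>(2), of "dist y z"] by (intro mult_right_mono) (simp_all add: mult.assoc)
      also have "conv k (\<lambda>s. f (X y s) - f (X z s)) t = conv k (\<lambda>s. f (X y s)) t - conv k (\<lambda>s. f (X z s)) t"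
        unfolding conv_def scaleR_diff_right
        by (intro integral_diff conv_singular_integrable weakly_singular_integrable[OF k t] cont)
      finally have "exp (- \<omega> * t) * norm (conv k (\<lambda>s. f (X y s)) t - conv k (\<lambda>s. f (X z s)) t)
          \<le> exp (- \<omega> * t) * (1 / 2 * dist y z * exp (\<omega> * t))"
        by (intro mult_left_mono) auto
      also have "\<dots> = 1 / 2 * dist y z" by (rule exp_cancel)
      also have "exp (- \<omega> * t) * norm (conv k (\<lambda>s. f (X y s)) t - conv k (\<lambda>s. f (X z s)) t) = dist (P y t) (P z t)"
        by (simp add: P_def dist_norm flip: scaleR_diff_right)
      finally show "dist (\<Psi> y t') (\<Psi> z t') \<le> 1 / 2 * dist y z" by (simp add: \<Psi> t_def)
    qed
  qed
  then obtain z where z: "\<Psi> z = z" by blast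
  show thesis
  proof (rule that)
    show "continuous_on {0..} (X z)" unfolding X_def by (intro continuous_on_scaleR continuous_intros continuous_on_apply_bcontfun)
    fix t :: real assume "t \<ge> 0"
    then have "z t = P z t" using \<Psi>[of z t] z by (simp add: max_def)
    then show "X z t = q t + conv k (\<lambda>s. f (X z s)) t"
      by (simp add: X_def P_def flip: exp_add)
  qed
qed

section \<open>The Abel kernel\<close>

text \<open>The factor \<open>1 / Gamma \<alpha>\<close> is left out of the kernel and carried by
  the field instead. The shift \<open>\<epsilon> = 0\<close> gives the original kernel,
  \<open>\<epsilon> > 0\<close> one that is continuous on the half-line.\<close>

definition abel_kernel :: "real \<Rightarrow> real \<Rightarrow> real \<Rightarrow> real" where
  "abel_kernel \<alpha> \<epsilon> t = (t + \<epsilon>) powr (\<alpha> - 1)"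

lemma continuous_on_abel_kernel: "\<epsilon> > 0 \<Longrightarrow> continuous_on {0..} (abel_kernel \<alpha> \<epsilon>)"
  unfolding abel_kernel_def by (intro continuous_intros) auto

lemma abel_kernel_pos: "\<epsilon> > 0 \<Longrightarrow> t \<ge> 0 \<Longrightarrow> abel_kernel \<alpha> \<epsilon> t > 0"
  by (simp add: abel_kernel_def)

lemma abel_kernel_antimono:
  "\<alpha> \<le> 1 \<Longrightarrow> \<epsilon> > 0 \<Longrightarrow> 0 \<le> s \<Longrightarrow> s \<le> t \<Longrightarrow> abel_kernel \<alpha> \<epsilon> t \<le> abel_kernel \<alpha> \<epsilon> s"
  unfolding abel_kernel_def by (rule powr_mono2') auto

text \<open>The two products of bases differ by \<open>s * (T - t) \<ge> 0\<close>, and the exponent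
  \<open>\<alpha> - 1 \<le> 0\<close> reverses the order.\<close>

lemma abel_kernel_log_convex:
  assumes "\<alpha> \<le> 1" "\<epsilon> > 0" "0 \<le> s" "s \<le> t" "t \<le> T"
  shows "abel_kernel \<alpha> \<epsilon> (T - s) * abel_kernel \<alpha> \<epsilon> t \<le> abel_kernel \<alpha> \<epsilon> T * abel_kernel \<alpha> \<epsilon> (t - s)"
proof -
  have "(T - s + \<epsilon>) * (t + \<epsilon>) - (T + \<epsilon>) * (t - s + \<epsilon>) = s * (T - t)" by (simp add: algebra_simps)
  also have "\<dots> \<ge> 0" using assms by simp
  finally have "((T - s + \<epsilon>) * (t + \<epsilon>)) powr (\<alpha> - 1) \<le> ((T + \<epsilon>) * (t - s + \<epsilon>)) powr (\<alpha> - 1)"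
    using assms by (intro powr_mono2') auto
  then show ?thesis using assms by (simp add: abel_kernel_def powr_mult)
qed

lemma has_integral_abel_kernel:
  assumes "\<alpha> > 0" "\<epsilon> \<ge> 0" "t \<ge> 0"
  shows "(abel_kernel \<alpha> \<epsilon> has_integral ((t + \<epsilon>) powr \<alpha> - \<epsilon> powr \<alpha>) / \<alpha>) {0..t}"
\<comment> \<open>For \<open>\<epsilon> = 0\<close> and \<open>\<alpha> < 1\<close> the primitive is
  not differentiable at the left endpoint, so the fundamental theorem is kept for the shifted
  kernels.\<close>
proof (cases "\<epsilon> = 0")
  case True
  then show ?thesis using has_integral_powr_from_0[of "\<alpha> - 1" t] assms
    by (simp add: abel_kernel_def[abs_def])
next
  case False
  have "(abel_kernel \<alpha> \<epsilon> has_integral (t + \<epsilon>) powr \<alpha> / \<alpha> - (0 + \<epsilon>) powr \<alpha> / \<alpha>) {0..t}"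
    unfolding abel_kernel_def[abs_def] using assms False
    by (intro fundamental_theorem_of_calculus)
      (auto intro!: derivative_eq_intros simp flip: has_real_derivative_iff_has_vector_derivative)
  then show ?thesis by (simp add: diff_divide_distrib)
qed

text \<open>Shifting lowers the kernel away from 0, so the absolute value disappears and the
  integral is \<open>(t powr \<alpha> - (t + \<epsilon>) powr \<alpha> + \<epsilon> powr \<alpha>) /
  \<alpha>\<close>. The bound is free of \<open>t\<close>, although each kernel alone has infinite
  mass on the half-line.\<close>

lemma abel_kernel_diff:
  assumes "0 < \<alpha>" "\<alpha> \<le> 1" "\<epsilon> > 0" "t \<ge> 0"
  shows "(\<lambda>s. abel_kernel \<alpha> 0 s - abel_kernel \<alpha> \<epsilon> s) absolutely_integrable_on {0..t}"
    and "integral {0..t} (\<lambda>s. \<bar>abel_kernel \<alpha> 0 s - abel_kernel \<alpha> \<epsilon> s\<bar>) \<le> \<epsilon> powr \<alpha> / \<alpha>"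
proof -
  define v where "v = ((t + 0) powr \<alpha> - 0 powr \<alpha>) / \<alpha> - ((t + \<epsilon>) powr \<alpha> - \<epsilon> powr \<alpha>) / \<alpha>"
  have 1: "((\<lambda>s. abel_kernel \<alpha> 0 s - abel_kernel \<alpha> \<epsilon> s) has_integral v) {0..t}"
    unfolding v_def using assms by (intro has_integral_diff has_integral_abel_kernel) auto
  \<comment> \<open>The point \<open>0\<close> is excluded since \<open>abel_kernel \<alpha> 0 0 = 0\<close> in HOL.\<close>
  have 2: "((\<lambda>s. \<bar>abel_kernel \<alpha> 0 s - abel_kernel \<alpha> \<epsilon> s\<bar>) has_integral v) {0..t}"
  proof (rule has_integral_spike_finite[OF _ _ 1, of "{0}"])
    fix s assume "s \<in> {0..t} - {0}"
    then have "abel_kernel \<alpha> \<epsilon> s \<le> abel_kernel \<alpha> 0 s"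
      unfolding abel_kernel_def using assms by (intro powr_mono2') auto
    then show "\<bar>abel_kernel \<alpha> 0 s - abel_kernel \<alpha> \<epsilon> s\<bar> = abel_kernel \<alpha> 0 s - abel_kernel \<alpha> \<epsilon> s" by simp
  qed simp
  show "(\<lambda>s. abel_kernel \<alpha> 0 s - abel_kernel \<alpha> \<epsilon> s) absolutely_integrable_on {0..t}"
    using 1 2 by (auto simp: absolutely_integrable_on_def integrable_on_def)
  have "t powr \<alpha> \<le> (t + \<epsilon>) powr \<alpha>" using assms by (intro powr_mono2) auto
  then have "v \<le> \<epsilon> powr \<alpha> / \<alpha>" using assms by (simp add: v_def field_simps)
  then show "integral {0..t} (\<lambda>s. \<bar>abel_kernel \<alpha> 0 s - abel_kernel \<alpha> \<epsilon> s\<bar>) \<le> \<epsilon> powr \<alpha> / \<alpha>"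
    using 2 by (simp add: integral_unique)
qed

lemma powr_small:
  fixes D \<eta> :: real
  assumes "\<alpha> > 0" "D \<ge> 0" "\<eta> > 0"
  obtains \<epsilon> where "\<epsilon> > 0" "\<epsilon> \<le> 1" "D * \<epsilon> powr \<alpha> < \<eta>"
proof
  \<comment> \<open>The minimum with 1 supplies \<open>\<epsilon> \<le> 1\<close>, which the decay
    estimate uses to bound \<open>\<epsilon> powr \<alpha>\<close> by 1; \<open>D + 1\<close> gives
    a nonzero denominator and the strict inequality.\<close>
  define \<epsilon> where "\<epsilon> = min 1 ((\<eta> / (D + 1)) powr (1 / \<alpha>))"
  show "\<epsilon> > 0" "\<epsilon> \<le> 1" using assms by (auto simp: \<epsilon>_def)
  have "\<epsilon> powr \<alpha> \<le> ((\<eta> / (D + 1)) powr (1 / \<alpha>)) powr \<alpha>"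
    using assms \<open>\<epsilon> > 0\<close> by (intro powr_mono2) (auto simp: \<epsilon>_def)
  also have "\<dots> = \<eta> / (D + 1)" using assms by (simp add: powr_powr)
  finally have "D * \<epsilon> powr \<alpha> \<le> D * (\<eta> / (D + 1))" using assms by (intro mult_left_mono)
  also have "\<dots> < \<eta>" using assms by (simp add: field_simps)
  finally show "D * \<epsilon> powr \<alpha> < \<eta>" .
qed

lemma weakly_singular_continuous:
  assumes "continuous_on {0..} k" "\<And>t. t \<ge> 0 \<Longrightarrow> \<bar>k t\<bar> \<le> K"
  shows "weakly_singular k"
  unfolding weakly_singular_def
proof (intro allI impI)
  fix \<eta> :: real assume "\<eta> > 0"
  then show "\<exists>l K. continuous_on {0..} l \<and> (\<forall>t\<ge>0. \<bar>l t\<bar> \<le> K) \<and>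
     (\<forall>t\<ge>0. (\<lambda>s. k s - l s) absolutely_integrable_on {0..t} \<and> integral {0..t} (\<lambda>s. \<bar>k s - l s\<bar>) \<le> \<eta>)"
    using assms by (intro exI[of _ k] exI[of _ K]) auto
qed

lemma abel_kernel_bounded: "\<alpha> \<le> 1 \<Longrightarrow> \<epsilon> > 0 \<Longrightarrow> t \<ge> 0 \<Longrightarrow> \<bar>abel_kernel \<alpha> \<epsilon> t\<bar> \<le> abel_kernel \<alpha> \<epsilon> 0"
  using abel_kernel_pos[of \<epsilon> t \<alpha>] abel_kernel_antimono[of \<alpha> \<epsilon> 0 t] by simp

lemma weakly_singular_abel_kernel:
  assumes "0 < \<alpha>" "\<alpha> \<le> 1"
  shows "weakly_singular (abel_kernel \<alpha> 0)"
  unfolding weakly_singular_def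
proof (intro allI impI)
  fix \<eta> :: real assume "\<eta> > 0"
  then obtain \<epsilon> where \<epsilon>: "\<epsilon> > 0" "1 / \<alpha> * \<epsilon> powr \<alpha> < \<eta>"
    using powr_small[of \<alpha> "1 / \<alpha>" \<eta>] assms by auto
  have "integral {0..t} (\<lambda>s. \<bar>abel_kernel \<alpha> 0 s - abel_kernel \<alpha> \<epsilon> s\<bar>) \<le> \<eta>" if "t \<ge> 0" for t
    using abel_kernel_diff(2)[OF assms \<epsilon>(1) that] \<epsilon>(2) by simp
  then show "\<exists>l K. continuous_on {0..} l \<and> (\<forall>t\<ge>0. \<bar>l t\<bar> \<le> K) \<and>
     (\<forall>t\<ge>0. (\<lambda>s. abel_kernel \<alpha> 0 s - l s) absolutely_integrable_on {0..t} \<and>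
       integral {0..t} (\<lambda>s. \<bar>abel_kernel \<alpha> 0 s - l s\<bar>) \<le> \<eta>)"
    using continuous_on_abel_kernel[OF \<epsilon>(1)] abel_kernel_bounded[OF assms(2) \<epsilon>(1)]
      abel_kernel_diff(1)[OF assms \<epsilon>(1)]
    by (intro exI[of _ "abel_kernel \<alpha> \<epsilon>"] exI[of _ "abel_kernel \<alpha> \<epsilon> 0"]) auto
qed

text \<open>The resolvent equation is itself a Volterra equation, with the kernel as forcing term
  and the linear field \<open>\<lambda>x. - \<mu> * x\<close>, so the existence theorem yields
  \<open>r\<close>; its forcing term has to be continuous and bounded, hence
  \<open>\<epsilon> > 0\<close>. As the kernel's integral grows without bound in \<open>t\<close>,
  the last property forces \<open>\<mu> * integral {0..t} r\<close> to 1.\<close>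

lemma abel_kernel_resolvent:
  assumes "0 < \<alpha>" "\<alpha> \<le> 1" "\<epsilon> > 0" "\<mu> > 0"
  obtains r where "is_resolvent (abel_kernel \<alpha> \<epsilon>) \<mu> r" "\<And>t. t \<ge> 0 \<Longrightarrow> r t \<ge> 0"
    "\<And>t. t \<ge> 0 \<Longrightarrow> \<mu> * integral {0..t} r \<le> 1"
    "\<And>t. t \<ge> 0 \<Longrightarrow> (1 - \<mu> * integral {0..t} r) * (1 + \<mu> * (((t + \<epsilon>) powr \<alpha> - \<epsilon> powr \<alpha>) / \<alpha>)) \<le> 1"
proof -
  note k = continuous_on_abel_kernel[OF \<open>\<epsilon> > 0\<close>] abel_kernel_pos[OF \<open>\<epsilon> > 0\<close>]
  have lip: "\<mu>-lipschitz_on UNIV (\<lambda>x :: real. - \<mu> * x)"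
    using \<open>\<mu> > 0\<close> by (intro lipschitz_onI) (auto simp: dist_real_def abs_mult simp flip: right_diff_distrib)
  have bnd: "\<bar>abel_kernel \<alpha> \<epsilon> t\<bar> \<le> abel_kernel \<alpha> \<epsilon> 0" if "t \<ge> 0" for t
    by (rule abel_kernel_bounded[OF assms(2,3) that])
  have "\<exists>r. continuous_on {0..} r \<and>
      (\<forall>t\<ge>0. r t = abel_kernel \<alpha> \<epsilon> t + conv (abel_kernel \<alpha> \<epsilon>) (\<lambda>s. - \<mu> * r s) t)"
  proof (rule volterra_solution_exists[OF weakly_singular_continuous[OF k(1) bnd] lip k(1)])
    show "norm (abel_kernel \<alpha> \<epsilon> t) \<le> abel_kernel \<alpha> \<epsilon> 0" if "t \<ge> 0" for t
      using bnd[OF that] by simp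
  qed blast+
  then obtain r where r: "continuous_on {0..} r"
    "\<And>t. t \<ge> 0 \<Longrightarrow> r t = abel_kernel \<alpha> \<epsilon> t + conv (abel_kernel \<alpha> \<epsilon>) (\<lambda>s. - \<mu> * r s) t"
    by blast
  have res: "is_resolvent (abel_kernel \<alpha> \<epsilon>) \<mu> r"
    using r conv_scaleR_right[of "abel_kernel \<alpha> \<epsilon>" "- \<mu>" r] by (simp add: is_resolvent_def)
  have nonneg: "r t \<ge> 0" if "t \<ge> 0" for t
    by (rule resolvent_nonneg[OF k _ _ \<open>\<mu> > 0\<close> res that])
      (auto intro: abel_kernel_antimono abel_kernel_log_convex assms)
  show thesis
  proof (rule that[OF res nonneg])
    fix t :: real assume t: "t \<ge> 0"
    show "\<mu> * integral {0..t} r \<le> 1"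
      by (rule resolvent_integral_le[OF k _ res nonneg \<open>\<mu> > 0\<close> t]) (auto intro: abel_kernel_antimono assms)
    show "(1 - \<mu> * integral {0..t} r) * (1 + \<mu> * (((t + \<epsilon>) powr \<alpha> - \<epsilon> powr \<alpha>) / \<alpha>)) \<le> 1"
      using resolvent_integral_ge[OF k res nonneg \<open>\<mu> > 0\<close> t]
        integral_unique[OF has_integral_abel_kernel[of \<alpha> \<epsilon> t]] assms t by simp
  qed
qed

section \<open>Norm estimates through the resolvent\<close>

lemma norm_volterra_le:
  fixes y F :: "real \<Rightarrow> 'a::euclidean_space"
  assumes \<alpha>: "0 < \<alpha>" "\<alpha> \<le> 1" and \<epsilon>: "\<epsilon> > 0" and "\<mu> > 0"
    and y: "continuous_on {0..} y" and F: "continuous_on {0..} F"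
    and eq: "\<And>t. t \<ge> 0 \<Longrightarrow> y t = y0 + conv (abel_kernel \<alpha> 0) F t"
    and G_le: "\<And>s. 0 \<le> s \<Longrightarrow> s \<le> t \<Longrightarrow> norm (F s + \<mu> *\<^sub>R y s) \<le> \<theta> * norm (y s)"
    and F_le: "\<And>s. 0 \<le> s \<Longrightarrow> s \<le> t \<Longrightarrow> norm (F s) \<le> C"
    and r: "is_resolvent (abel_kernel \<alpha> \<epsilon>) \<mu> r" and nonneg: "\<And>t. t \<ge> 0 \<Longrightarrow> r t \<ge> 0"
    and le_1: "\<mu> * integral {0..t} r \<le> 1" and t: "t \<ge> 0"
  shows "norm (y t) \<le> (1 - \<mu> * integral {0..t} r) * norm y0 + \<theta> * conv r (\<lambda>s. norm (y s)) t
      + 2 * C / \<alpha> * \<epsilon> powr \<alpha>"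
proof -
  define k where "k = abel_kernel \<alpha> \<epsilon>"
  define G where "G = (\<lambda>s. F s + \<mu> *\<^sub>R y s)"
  \<comment> \<open>\<open>e\<close> is the defect from replacing the singular kernel by the shifted
    one. With \<open>F = G - \<mu> y\<close> the equation becomes
    \<open>y + \<mu> conv k y = q\<close>, so the defect enters the solution formula twice, as
    \<open>e\<close> and as \<open>- \<mu> conv r e\<close>. Each is at most
    \<open>C / \<alpha> * \<epsilon> powr \<alpha>\<close>, whence the factor 2 in the
    conclusion.\<close>
  define e where "e = (\<lambda>t. conv (abel_kernel \<alpha> 0) F t - conv k F t)"
  define q where "q = (\<lambda>t. y0 + (conv k G t + e t))"
  have ck: "continuous_on {0..} k" unfolding k_def by (rule continuous_on_abel_kernel[OF \<epsilon>])
  have cr: "continuous_on {0..} r" and req: "\<And>t. t \<ge> 0 \<Longrightarrow> r t + \<mu> * conv k r t = k t"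
    using r by (auto simp: is_resolvent_def k_def)
  have cG: "continuous_on {0..} G" unfolding G_def by (intro continuous_intros y F)
  have ce: "continuous_on {0..} e"
    unfolding e_def
    by (intro continuous_on_diff continuous_on_conv ck F
        continuous_on_conv_weakly_singular[OF weakly_singular_abel_kernel[OF \<alpha>]])
  have ckG: "continuous_on {0..} (conv k G)" by (intro continuous_on_conv ck cG)
  have ckr: "continuous_on {0..} (conv k r)" by (intro continuous_on_conv ck cr)
  have cq: "continuous_on {0..} q" unfolding q_def by (intro continuous_on_add continuous_on_const ckG ce)
  have sub: "continuous_on {0..u} f" if "continuous_on {0..} f" for f :: "real \<Rightarrow> 'b::topological_space" and u
    by (rule continuous_on_subset[OF that]) auto
  have "y u + \<mu> *\<^sub>R conv k y u = q u" if "u \<ge> 0" for u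
  proof -
    have "conv k G u = conv k F u + \<mu> *\<^sub>R conv k y u"
      unfolding G_def conv_scaleR_right[symmetric]
      by (rule conv_add_right) (intro ck sub F y continuous_on_scaleR continuous_on_const)+
    then show ?thesis using eq[OF that] by (simp add: q_def e_def)
  qed
  then have "y t = q t - \<mu> *\<^sub>R conv r q t"
    by (intro resolvent_solution[OF ck r[folded k_def] y cq _ t])
  also have "conv r q t = conv r (\<lambda>_. y0) t + (conv r (conv k G) t + conv r e t)"
    unfolding q_def
    by (subst conv_add_right; (subst conv_add_right)?) (intro cr sub ckG ce continuous_on_add continuous_on_const refl)+
  also have "conv r (\<lambda>_. y0) t = integral {0..t} r *\<^sub>R y0"
  proof -
    have "conv r (\<lambda>_. y0) t = integral {0..t} (\<lambda>s. r s *\<^sub>R y0)" by (rule conv_reflect)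
    also have "\<dots> = integral {0..t} r *\<^sub>R y0"
      using integral_linear[OF integrable_continuous_interval[OF sub[OF cr]] bounded_linear_scaleR_left[of y0]]
      by (simp add: o_def)
    finally show ?thesis .
  qed
  also have "q t = y0 + (conv k G t + e t)" by (simp add: q_def)
  \<comment> \<open>The second summand cancels against its counterpart in
    \<open>\<mu> *\<^sub>R conv r q t\<close>, so that \<open>G\<close> is convolved with the
    nonnegative kernel \<open>r\<close> alone.\<close>
  also have "conv k G t = conv r G t + \<mu> *\<^sub>R conv r (conv k G) t"
  proof -
    have "conv k G t = conv (\<lambda>s. r s + \<mu> * conv k r s) G t" by (rule conv_cong) (auto simp: req)
    also have "\<dots> = conv r G t + \<mu> *\<^sub>R conv (conv k r) G t"
      unfolding conv_scaleR_left[symmetric]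
      by (rule conv_add_left) (intro cr sub cG ckr continuous_on_mult continuous_on_const)+
    also have "conv (conv k r) G t = conv (conv r k) G t" by (rule conv_cong) (auto simp: conv_commute)
    also have "\<dots> = conv r (conv k G) t" by (rule conv_assoc[symmetric]) (intro cr ck cG)+
    finally show ?thesis .
  qed
  finally have "y t = (1 - \<mu> * integral {0..t} r) *\<^sub>R y0 + conv r G t + e t - \<mu> *\<^sub>R conv r e t"
    by (simp add: algebra_simps)
  then have "norm (y t) \<le> norm ((1 - \<mu> * integral {0..t} r) *\<^sub>R y0) + norm (conv r G t) + norm (e t) + norm (\<mu> *\<^sub>R conv r e t)"
    by (smt (verit) norm_triangle_ineq norm_triangle_ineq4)
  moreover have "norm ((1 - \<mu> * integral {0..t} r) *\<^sub>R y0) = (1 - \<mu> * integral {0..t} r) * norm y0"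
    using le_1 by simp
  moreover have "norm (conv r G t) \<le> \<theta> * conv r (\<lambda>s. norm (y s)) t"
  proof -
    have "norm (conv r G t) \<le> integral {0..t} (\<lambda>s. \<theta> * (r (t - s) *\<^sub>R norm (y s)))"
      unfolding conv_def
    proof (rule integral_norm_bound_integral)
      show "(\<lambda>s. r (t - s) *\<^sub>R G s) integrable_on {0..t}" by (rule conv_integrable[OF cr sub[OF cG]])
      show "(\<lambda>s. \<theta> * (r (t - s) *\<^sub>R norm (y s))) integrable_on {0..t}"
        by (intro integrable_on_mult_right conv_integrable[OF cr] sub continuous_on_norm y)
      fix s assume s: "s \<in> {0..t}"
      then have "norm (G s) \<le> \<theta> * norm (y s)" unfolding G_def by (intro G_le) auto
      from mult_left_mono[OF this nonneg[of "t - s"]] s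
      show "norm (r (t - s) *\<^sub>R G s) \<le> \<theta> * (r (t - s) *\<^sub>R norm (y s))"
        using nonneg[of "t - s"] by (simp add: mult_ac)
    qed
    then show ?thesis by (simp add: conv_def)
  qed
  moreover have e_le: "norm (e u) \<le> C / \<alpha> * \<epsilon> powr \<alpha>" if u: "0 \<le> u" "u \<le> t" for u
  proof -
    have "e u = conv (\<lambda>s. abel_kernel \<alpha> 0 s - k s) F u"
      unfolding e_def
      by (rule conv_diff_left[symmetric])
        (intro weakly_singular_integrable[OF weakly_singular_abel_kernel[OF \<alpha>]] u
          absolutely_integrable_continuous_atLeast ck sub F)+
    also have "norm \<dots> \<le> C * integral {0..u} (\<lambda>s. \<bar>abel_kernel \<alpha> 0 s - k s\<bar>)"
      unfolding k_def
      by (rule norm_conv_le[OF abel_kernel_diff(1)[OF \<alpha> \<epsilon>] sub[OF F]]) (use u in \<open>auto intro!: F_le\<close>)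
    also have "\<dots> \<le> C * (\<epsilon> powr \<alpha> / \<alpha>)"
      unfolding k_def using abel_kernel_diff(2)[OF \<alpha> \<epsilon>, of u] u order_trans[OF norm_ge_zero F_le[of 0]] t
      by (intro mult_left_mono) auto
    finally show ?thesis by simp
  qed
  moreover have "norm (\<mu> *\<^sub>R conv r e t) \<le> C / \<alpha> * \<epsilon> powr \<alpha>"
  proof -
    have "norm (conv r e t) \<le> C / \<alpha> * \<epsilon> powr \<alpha> * integral {0..t} (\<lambda>s. \<bar>r s\<bar>)"
    proof (rule norm_conv_le[OF absolutely_integrable_continuous_atLeast[OF cr] sub[OF ce]])
      fix s assume "s \<in> {0..t}"
      then show "norm (e s) \<le> C / \<alpha> * \<epsilon> powr \<alpha>" by (intro e_le) auto
    qed
    also have "integral {0..t} (\<lambda>s. \<bar>r s\<bar>) = integral {0..t} r"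
      by (rule integral_cong) (auto simp: nonneg)
    finally have "\<mu> * norm (conv r e t) \<le> C / \<alpha> * \<epsilon> powr \<alpha> * (\<mu> * integral {0..t} r)"
      using mult_left_mono[of _ _ \<mu>] \<open>\<mu> > 0\<close> by (fastforce simp: mult_ac)
    also have "\<dots> \<le> C / \<alpha> * \<epsilon> powr \<alpha> * 1"
      by (rule mult_left_mono[OF le_1]) (use order_trans[OF norm_ge_zero e_le[of 0]] t in simp)
    finally show ?thesis using \<open>\<mu> > 0\<close> by simp
  qed
  moreover note e_le[OF t order_refl]
  moreover have "2 * C / \<alpha> * \<epsilon> powr \<alpha> = C / \<alpha> * \<epsilon> powr \<alpha> + C / \<alpha> * \<epsilon> powr \<alpha>" by simp
  ultimately show ?thesis by linarith
qed

text \<open>At a maximum point of \<open>norm (y s)\<close> on \<open>{0..T}\<close>, with value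
  \<open>M\<close>, the resolvent formula bounds \<open>M\<close> by a convex combination of
  \<open>norm y0\<close> and \<open>\<theta> / \<mu> * M\<close>, with weights
  \<open>1 - \<mu> * R\<close> and \<open>\<mu> * R\<close>, plus the kernel error. If
  \<open>M > norm y0\<close>, both are at least \<open>M - m > 0\<close> below \<open>M\<close>;
  this margin does not depend on the resolvent, so \<epsilon> can be chosen to keep the error under
  it.\<close>

lemma volterra_bounded:
  fixes y F :: "real \<Rightarrow> 'a::euclidean_space"
  assumes \<alpha>: "0 < \<alpha>" "\<alpha> \<le> 1" and "\<mu> > 0" "0 \<le> \<theta>" "\<theta> < \<mu>"
    and y: "continuous_on {0..} y" and F: "continuous_on {0..} F"
    and eq: "\<And>t. t \<ge> 0 \<Longrightarrow> y t = y0 + conv (abel_kernel \<alpha> 0) F t"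
    and G_le: "\<And>s. 0 \<le> s \<Longrightarrow> s \<le> T \<Longrightarrow> norm (F s + \<mu> *\<^sub>R y s) \<le> \<theta> * norm (y s)"
    and t: "0 \<le> t" "t \<le> T"
  shows "norm (y t) \<le> norm y0"
proof (rule ccontr)
  assume *: "\<not> norm (y t) \<le> norm y0"
  have sub: "continuous_on {0..u} f" if "continuous_on {0..} f" for f :: "real \<Rightarrow> 'b::topological_space" and u
    by (rule continuous_on_subset[OF that]) auto
  have "bounded (F ` {0..T})"
    by (intro compact_imp_bounded compact_continuous_image sub F) auto
  then obtain C where C: "C > 0" "\<And>s. 0 \<le> s \<Longrightarrow> s \<le> T \<Longrightarrow> norm (F s) \<le> C"
    unfolding bounded_pos by auto
  obtain u where u: "u \<in> {0..T}" "\<And>s. s \<in> {0..T} \<Longrightarrow> norm (y s) \<le> norm (y u)"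
    using continuous_attains_sup[OF compact_Icc _ continuous_on_norm[OF sub[OF y, of T]]] t by auto
  define M where "M = norm (y u)"
  define m where "m = max (norm y0) (\<theta> / \<mu> * M)"
  have "norm y0 < M" using * u(2)[of t] t by (simp add: M_def)
  then have "M > 0" using norm_ge_zero[of y0] by linarith
  have "\<theta> / \<mu> * M < 1 * M" using \<open>\<theta> < \<mu>\<close> \<open>\<mu> > 0\<close> \<open>M > 0\<close> by (intro mult_strict_right_mono) auto
  with \<open>norm y0 < M\<close> have "m < M" by (simp add: m_def)
  obtain \<epsilon> where \<epsilon>: "\<epsilon> > 0" "2 * C / \<alpha> * \<epsilon> powr \<alpha> < M - m"
    using powr_small[of \<alpha> "2 * C / \<alpha>" "M - m"] \<alpha> C(1) \<open>m < M\<close> by auto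
  obtain r where r: "is_resolvent (abel_kernel \<alpha> \<epsilon>) \<mu> r" "\<And>t. t \<ge> 0 \<Longrightarrow> r t \<ge> 0"
    "\<And>t. t \<ge> 0 \<Longrightarrow> \<mu> * integral {0..t} r \<le> 1"
    using abel_kernel_resolvent[OF \<alpha> \<epsilon>(1) \<open>\<mu> > 0\<close>] by metis
  have cr: "continuous_on {0..} r" using r(1) by (simp add: is_resolvent_def)
  define R where "R = integral {0..u} r"
  have R: "0 \<le> R" "\<mu> * R \<le> 1"
    using r(2,3) u(1) by (auto simp: R_def intro!: integral_nonneg integrable_continuous_interval sub[OF cr])
  have "conv r (\<lambda>s. norm (y s)) u \<le> norm (conv r (\<lambda>s. norm (y s)) u)" by simp
  also have "\<dots> \<le> M * integral {0..u} (\<lambda>s. \<bar>r s\<bar>)"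
    by (rule norm_conv_le[OF absolutely_integrable_continuous_atLeast[OF cr] continuous_on_norm[OF sub[OF y]]])
      (use u in \<open>auto simp: M_def\<close>)
  also have "integral {0..u} (\<lambda>s. \<bar>r s\<bar>) = R"
    unfolding R_def by (rule integral_cong) (auto simp: r(2))
  finally have conv_le: "conv r (\<lambda>s. norm (y s)) u \<le> M * R" .
  have "M \<le> (1 - \<mu> * R) * norm y0 + \<theta> * conv r (\<lambda>s. norm (y s)) u + 2 * C / \<alpha> * \<epsilon> powr \<alpha>"
    unfolding M_def R_def
    by (rule norm_volterra_le[OF \<alpha> \<epsilon>(1) \<open>\<mu> > 0\<close> y F eq _ _ r(1) r(2) r(3)])
      (use u in \<open>auto intro!: G_le C(2)\<close>)
  also have "(1 - \<mu> * R) * norm y0 \<le> (1 - \<mu> * R) * m"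
    using R by (intro mult_left_mono) (auto simp: m_def)
  also have "\<theta> * conv r (\<lambda>s. norm (y s)) u \<le> \<theta> * (M * R)"
    using conv_le \<open>0 \<le> \<theta>\<close> by (rule mult_left_mono)
  also have "\<theta> * (M * R) = (\<mu> * R) * (\<theta> / \<mu> * M)" using \<open>\<mu> > 0\<close> by simp
  also have "\<dots> \<le> (\<mu> * R) * m"
    using R \<open>\<mu> > 0\<close> by (intro mult_left_mono) (auto simp: m_def)
  finally show False using \<epsilon>(2) by (simp add: algebra_simps)
qed

text \<open>The convolution is split at \<open>A\<close>. Times after \<open>A\<close> carry the
  bound \<open>b\<close> and a mass of \<open>r\<close> at most \<open>1 / \<mu>\<close>, which
  gives \<open>\<theta> / \<mu> * b\<close>. The values before \<open>A\<close> and the initial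
  value share only the mass missing from \<open>{0..t - A}\<close>, which becomes small as
  \<open>t\<close> grows; \<eta> is divided between this and the kernel error.\<close>

lemma volterra_decay_step:
  fixes y F :: "real \<Rightarrow> 'a::euclidean_space"
  assumes \<alpha>: "0 < \<alpha>" "\<alpha> \<le> 1" and "\<mu> > 0" "0 \<le> \<theta>" "\<theta> < \<mu>"
    and y: "continuous_on {0..} y" and F: "continuous_on {0..} F"
    and eq: "\<And>t. t \<ge> 0 \<Longrightarrow> y t = y0 + conv (abel_kernel \<alpha> 0) F t"
    and G_le: "\<And>s. 0 \<le> s \<Longrightarrow> norm (F s + \<mu> *\<^sub>R y s) \<le> \<theta> * norm (y s)"
    and F_le: "\<And>s. 0 \<le> s \<Longrightarrow> norm (F s) \<le> C"
    and b: "b \<ge> 0" "A \<ge> 0" "\<And>t. t \<ge> A \<Longrightarrow> norm (y t) \<le> b" and "\<eta> > 0"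
  obtains B where "B \<ge> 0" "\<And>t. t \<ge> B \<Longrightarrow> norm (y t) \<le> \<theta> / \<mu> * b + \<eta>"
proof -
  define Y where "Y = norm y0"
  have yY: "norm (y t) \<le> Y" if "t \<ge> 0" for t
    unfolding Y_def
    by (rule volterra_bounded[OF \<alpha> \<open>\<mu> > 0\<close> \<open>0 \<le> \<theta>\<close> \<open>\<theta> < \<mu>\<close> y F eq G_le that order_refl])
  have "Y \<ge> 0" by (simp add: Y_def)
  have "C \<ge> 0" using order_trans[OF norm_ge_zero F_le[of 0]] by simp
  have sub: "continuous_on {0..u} f" if "continuous_on {0..} f" for f :: "real \<Rightarrow> 'b::topological_space" and u
    by (rule continuous_on_subset[OF that]) auto
  \<comment> \<open>\<open>X\<close> and \<open>U\<close> are solved from the lower bound on the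
    mass of \<open>r\<close>: for \<open>u \<ge> U\<close> it gives
    \<open>(1 - \<mu> * integral {0..u} r) * X \<le> 1\<close>, that is, at most
    \<open>\<eta> / 2\<close> after multiplying the first factor by \<open>Y\<close>. The summand 1
    in \<open>U\<close> absorbs \<open>\<epsilon> powr \<alpha> \<le> 1\<close>.\<close>
  define X where "X = 2 * Y / \<eta>"
  have "X \<ge> 0" using \<open>Y \<ge> 0\<close> \<open>\<eta> > 0\<close> by (simp add: X_def)
  define U where "U = (1 + \<alpha> * X / \<mu>) powr (1 / \<alpha>)"
  have U: "U \<ge> 0" by (simp add: U_def)
  obtain \<epsilon> where \<epsilon>: "\<epsilon> > 0" "\<epsilon> \<le> 1" "2 * C / \<alpha> * \<epsilon> powr \<alpha> < \<eta> / 2"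
    using powr_small[of \<alpha> "2 * C / \<alpha>" "\<eta> / 2"] \<alpha> \<open>C \<ge> 0\<close> \<open>\<eta> > 0\<close> by auto
  obtain r where r: "is_resolvent (abel_kernel \<alpha> \<epsilon>) \<mu> r" "\<And>t. t \<ge> 0 \<Longrightarrow> r t \<ge> 0"
    "\<And>t. t \<ge> 0 \<Longrightarrow> \<mu> * integral {0..t} r \<le> 1"
    "\<And>t. t \<ge> 0 \<Longrightarrow> (1 - \<mu> * integral {0..t} r) * (1 + \<mu> * (((t + \<epsilon>) powr \<alpha> - \<epsilon> powr \<alpha>) / \<alpha>)) \<le> 1"
    using abel_kernel_resolvent[OF \<alpha> \<epsilon>(1) \<open>\<mu> > 0\<close>] by metis
  have cr: "continuous_on {0..} r" using r(1) by (simp add: is_resolvent_def)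
  have r_int: "r integrable_on {0..u}" for u by (intro integrable_continuous_interval sub cr)
  have small: "Y * (1 - \<mu> * integral {0..u} r) \<le> \<eta> / 2" if u: "u \<ge> U" for u
  proof -
    have "1 + \<alpha> * X / \<mu> \<ge> 0" using \<alpha> \<open>\<mu> > 0\<close> \<open>X \<ge> 0\<close> by simp
    then have "1 + \<alpha> * X / \<mu> = U powr \<alpha>" using \<alpha> by (simp add: U_def powr_powr)
    also have "\<dots> \<le> (u + \<epsilon>) powr \<alpha>" using u U \<epsilon> \<alpha> by (intro powr_mono2) auto
    finally have "\<alpha> * X / \<mu> \<le> (u + \<epsilon>) powr \<alpha> - \<epsilon> powr \<alpha>"
      using powr_le1[of \<alpha> \<epsilon>] \<epsilon> \<alpha> by simp
    then have "X \<le> \<mu> * (((u + \<epsilon>) powr \<alpha> - \<epsilon> powr \<alpha>) / \<alpha>)"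
      using \<alpha> \<open>\<mu> > 0\<close> by (simp add: field_simps)
    then have "(1 - \<mu> * integral {0..u} r) * X
        \<le> (1 - \<mu> * integral {0..u} r) * (1 + \<mu> * (((u + \<epsilon>) powr \<alpha> - \<epsilon> powr \<alpha>) / \<alpha>))"
      using r(3)[of u] u U by (intro mult_left_mono) auto
    also have "\<dots> \<le> 1" using r(4)[of u] u U by simp
    finally show ?thesis using \<open>\<eta> > 0\<close> by (simp add: X_def field_simps)
  qed
  show thesis
  proof (rule that)
    show "A + U \<ge> 0" using b U by simp
    fix t assume t: "t \<ge> A + U"
    define R where "R = integral {0..t - A} r"
    define R' where "R' = integral {0..t} r"
    have tA: "t - A \<ge> U" "t - A \<ge> 0" "t \<ge> 0" using t U b by auto
    have R: "0 \<le> R" "\<mu> * R \<le> 1"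
      using r(2,3) tA unfolding R_def by (auto intro!: integral_nonneg r_int)
    define g where "g = (\<lambda>s. r (t - s))"
    have g_int: "g integrable_on {0..t}"
      using has_integral_reflect_0[OF integrable_integral[OF r_int[of t]]] unfolding g_def by blast
    have g_0: "integral {0..t} g = R'"
      unfolding g_def R'_def
      using has_integral_reflect_0[OF integrable_integral[OF r_int[of t]]] by (rule integral_unique)
    have "integral {A..t} g = integral {A-A..t-A} (\<lambda>s. g (s + A))"
      by (rule integral_shift_real_ivl[symmetric])
    also have "\<dots> = integral {0..t - A} (\<lambda>s. r (t - A - s))" by (simp add: g_def algebra_simps)
    also have "\<dots> = R"
      unfolding R_def
      using has_integral_reflect_0[OF integrable_integral[OF r_int[of "t - A"]]] by (rule integral_unique)
    finally have g_A: "integral {A..t} g = R" .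
    have split: "integral {0..A} f + integral {A..t} f = integral {0..t} f"
      if "f integrable_on {0..t}" for f :: "real \<Rightarrow> real"
      using that tA b by (intro Henstock_Kurzweil_Integration.integral_combine) auto
    have yr_int: "(\<lambda>s. g s * norm (y s)) integrable_on {0..t}"
      using conv_integrable[OF cr continuous_on_norm[OF sub[OF y]]] by (simp add: g_def)
    have sub_int: "f integrable_on {0..A}" "f integrable_on {A..t}" if "f integrable_on {0..t}" for f :: "real \<Rightarrow> real"
      using integrable_subinterval_real[OF that] tA b by auto
    have "conv r (\<lambda>s. norm (y s)) t = integral {0..t} (\<lambda>s. g s * norm (y s))"
      by (simp add: conv_def g_def)
    also have "\<dots> = integral {0..A} (\<lambda>s. g s * norm (y s)) + integral {A..t} (\<lambda>s. g s * norm (y s))"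
      by (rule split[OF yr_int, symmetric])
    also have "\<dots> \<le> integral {0..A} (\<lambda>s. g s * Y) + integral {A..t} (\<lambda>s. g s * b)"
    proof (intro add_mono integral_le sub_int yr_int integrable_on_mult_left g_int)
      show "g s * norm (y s) \<le> g s * Y" if "s \<in> {0..A}" for s
        using that tA U by (intro mult_left_mono yY) (auto simp: g_def intro!: r(2))
      show "g s * norm (y s) \<le> g s * b" if "s \<in> {A..t}" for s
        using that b by (intro mult_left_mono b) (auto simp: g_def intro!: r(2))
    qed
    also have "\<dots> = (R' - R) * Y + R * b"
      using split[OF g_int] g_0 g_A by simp
    finally have conv_le: "conv r (\<lambda>s. norm (y s)) t \<le> (R' - R) * Y + R * b" .
    have "R \<le> R'" unfolding R_def R'_def
      using b r(2) by (intro integral_subset_le r_int) auto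
    have "norm (y t) \<le> (1 - \<mu> * R') * norm y0 + \<theta> * conv r (\<lambda>s. norm (y s)) t + 2 * C / \<alpha> * \<epsilon> powr \<alpha>"
      unfolding R'_def
      by (rule norm_volterra_le[OF \<alpha> \<epsilon>(1) \<open>\<mu> > 0\<close> y F eq G_le F_le r(1) r(2) r(3)]) (use tA in auto)
    also have "\<theta> * conv r (\<lambda>s. norm (y s)) t \<le> \<theta> * ((R' - R) * Y + R * b)"
      using conv_le \<open>0 \<le> \<theta>\<close> by (rule mult_left_mono)
    \<comment> \<open>Replacing \<theta> by \<mu> in front of \<open>(R' - R) * Y\<close> lets this
      term join the weight \<open>1 - \<mu> * R'\<close> of the initial value and gives
      \<open>Y * (1 - \<mu> * R)\<close>.\<close>
    also have "\<dots> \<le> \<mu> * (R' - R) * Y + \<theta> / \<mu> * b"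
    proof -
      have "\<theta> * ((R' - R) * Y) \<le> \<mu> * ((R' - R) * Y)"
        using \<open>\<theta> < \<mu>\<close> \<open>R \<le> R'\<close> \<open>Y \<ge> 0\<close> by (intro mult_right_mono) auto
      moreover have "(\<mu> * R) * (\<theta> / \<mu> * b) \<le> 1 * (\<theta> / \<mu> * b)"
        using R(2) b(1) \<open>0 \<le> \<theta>\<close> \<open>\<mu> > 0\<close> by (intro mult_right_mono) auto
      moreover have "(\<mu> * R) * (\<theta> / \<mu> * b) = \<theta> * (R * b)" using \<open>\<mu> > 0\<close> by simp
      ultimately show ?thesis by (simp add: distrib_left mult.assoc)
    qed
    finally have "norm (y t) \<le> Y * (1 - \<mu> * R) + \<theta> / \<mu> * b + 2 * C / \<alpha> * \<epsilon> powr \<alpha>"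
      by (simp add: Y_def algebra_simps)
    then show "norm (y t) \<le> \<theta> / \<mu> * b + \<eta>"
      using small[OF tA(1)] \<epsilon>(3) by (simp add: R_def)
  qed
qed

lemma volterra_tendsto_0:
  fixes y F :: "real \<Rightarrow> 'a::euclidean_space"
  assumes \<alpha>: "0 < \<alpha>" "\<alpha> \<le> 1" and "\<mu> > 0" "0 \<le> \<theta>" "\<theta> < \<mu>"
    and y: "continuous_on {0..} y" and F: "continuous_on {0..} F"
    and eq: "\<And>t. t \<ge> 0 \<Longrightarrow> y t = y0 + conv (abel_kernel \<alpha> 0) F t"
    and G_le: "\<And>s. 0 \<le> s \<Longrightarrow> norm (F s + \<mu> *\<^sub>R y s) \<le> \<theta> * norm (y s)"
    and F_le: "\<And>s. 0 \<le> s \<Longrightarrow> norm (F s) \<le> C"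
  shows "(y \<longlongrightarrow> 0) at_top"
proof (rule tendstoI)
  fix e :: real assume "e > 0"
  \<comment> \<open>Midway between \<open>\<theta> / \<mu>\<close> and 1. The slack
    \<open>(\<rho> - \<theta> / \<mu>) * b\<close> in the decay step makes each step multiply the
    eventual bound by exactly \<rho>.\<close>
  define \<rho> where "\<rho> = (1 + \<theta> / \<mu>) / 2"
  have \<rho>: "0 < \<rho>" "\<rho> < 1" "\<theta> / \<mu> < \<rho>"
    using \<open>\<mu> > 0\<close> \<open>0 \<le> \<theta>\<close> \<open>\<theta> < \<mu>\<close> by (auto simp: \<rho>_def field_simps)
  define Y where "Y = norm y0 + 1"
  have "Y > 0" by (simp add: Y_def add_nonneg_pos)
  have "\<exists>A\<ge>0. \<forall>t\<ge>A. norm (y t) \<le> Y * \<rho> ^ n" for n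
  proof (induction n)
    case 0
    have "norm (y t) \<le> Y" if "t \<ge> 0" for t
      using volterra_bounded[OF \<alpha> \<open>\<mu> > 0\<close> \<open>0 \<le> \<theta>\<close> \<open>\<theta> < \<mu>\<close> y F eq G_le that order_refl]
      by (simp add: Y_def)
    then show ?case by auto
  next
    case (Suc n)
    then obtain A where A: "A \<ge> 0" "\<And>t. t \<ge> A \<Longrightarrow> norm (y t) \<le> Y * \<rho> ^ n" by auto
    define b where "b = Y * \<rho> ^ n"
    have "b > 0" using \<open>Y > 0\<close> \<rho> by (simp add: b_def)
    then have "(\<rho> - \<theta> / \<mu>) * b > 0" using \<rho> by simp
    then obtain B where B: "B \<ge> 0" "\<And>t. t \<ge> B \<Longrightarrow> norm (y t) \<le> \<theta> / \<mu> * b + (\<rho> - \<theta> / \<mu>) * b"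
      using volterra_decay_step[OF \<alpha> \<open>\<mu> > 0\<close> \<open>0 \<le> \<theta>\<close> \<open>\<theta> < \<mu>\<close> y F eq G_le F_le less_imp_le[OF \<open>b > 0\<close>] A(1)]
        A(2)[folded b_def] by metis
    have "\<theta> / \<mu> * b + (\<rho> - \<theta> / \<mu>) * b = Y * \<rho> ^ Suc n" by (simp add: b_def algebra_simps)
    with B show ?case by auto
  qed
  moreover obtain n where "\<rho> ^ n < e / Y"
    using real_arch_pow_inv[of "e / Y" \<rho>] \<open>e > 0\<close> \<open>Y > 0\<close> \<rho> by auto
  then have "Y * \<rho> ^ n < e" using \<open>Y > 0\<close> by (simp add: field_simps)
  ultimately show "\<forall>\<^sub>F t in at_top. dist (y t) 0 < e"
    unfolding eventually_at_top_linorder by (metis dist_0_norm dist_commute le_less_trans)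
qed

section \<open>Dissipative vector fields\<close>

lemma caputo_solution_iff_conv:
  "caputo_solution \<alpha> f x0 x \<longleftrightarrow> continuous_on {0..} x \<and>
     (\<forall>t\<ge>0. x t = x0 + conv (abel_kernel \<alpha> 0) (\<lambda>s. (1 / Gamma \<alpha>) *\<^sub>R f (x s)) t)"
  by (simp only: caputo_solution_def riemann_liouville_def conv_scaleR_right)
    (simp add: conv_def abel_kernel_def)

text \<open>The choice of \<mu> amounts to \<open>L\<^sup>2 = \<mu> * c - c\<^sup>2\<close>, so on
  expanding the square the term from \<open>norm w\<close> is absorbed by half of the dissipation
  \<open>2 * \<mu> * c\<close>. What remains is
  \<open>(\<mu> - c / 2)\<^sup>2 - (5 / 4) * c\<^sup>2\<close> times
  \<open>(norm v)\<^sup>2\<close>. The summand \<open>c\<close> in \<mu> also ensures that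
  \<open>\<mu> - c / 2\<close> is nonnegative.\<close>

lemma norm_add_scaleR_le_of_dissipative:
  fixes v w :: "'a::real_inner"
  assumes "v \<bullet> w \<le> - c * (norm v)\<^sup>2" "norm w \<le> L * norm v" "c > 0" "\<mu> = L\<^sup>2 / c + c"
  shows "norm (w + \<mu> *\<^sub>R v) \<le> (\<mu> - c / 2) * norm v"
proof (rule power2_le_imp_le)
  have "L\<^sup>2 / c \<ge> 0" using assms by simp
  then have \<mu>: "\<mu> \<ge> c" "\<mu> > 0" using assms(3,4) by linarith+
  have L: "L\<^sup>2 = \<mu> * c - c\<^sup>2" using assms by (simp add: field_simps power2_eq_square)
  have "(norm w)\<^sup>2 \<le> (L * norm v)\<^sup>2" using assms(2) by (intro power_mono) auto
  then have 1: "w \<bullet> w \<le> (\<mu> * c - c\<^sup>2) * (v \<bullet> v)"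
    by (simp add: power_mult_distrib power2_norm_eq_inner L)
  have "(norm (w + \<mu> *\<^sub>R v))\<^sup>2 = w \<bullet> w + (2 * \<mu>) * (v \<bullet> w) + \<mu>\<^sup>2 * (v \<bullet> v)"
    unfolding power2_norm_eq_inner by (simp add: inner_simps inner_commute power2_eq_square algebra_simps)
  also have "(2 * \<mu>) * (v \<bullet> w) \<le> (2 * \<mu>) * (- c * (v \<bullet> v))"
    using assms(1) \<mu> by (intro mult_left_mono) (auto simp: power2_norm_eq_inner)
  also note 1
  also have "(\<mu> * c - c\<^sup>2) * (v \<bullet> v) + 2 * \<mu> * (- c * (v \<bullet> v)) + \<mu>\<^sup>2 * (v \<bullet> v)
      = (\<mu> - c / 2)\<^sup>2 * (v \<bullet> v) - (5 / 4) * c\<^sup>2 * (v \<bullet> v)"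
    by (simp add: power2_eq_square algebra_simps)
  also have "\<dots> \<le> (\<mu> - c / 2)\<^sup>2 * (v \<bullet> v)" by simp
  also have "\<dots> = ((\<mu> - c / 2) * norm v)\<^sup>2" by (simp add: power_mult_distrib power2_norm_eq_inner)
  finally show "(norm (w + \<mu> *\<^sub>R v))\<^sup>2 \<le> ((\<mu> - c / 2) * norm v)\<^sup>2" by simp
  show "0 \<le> (\<mu> - c / 2) * norm v" using \<mu> assms by simp
qed

lemma volterra_dissipative_bounded:
  fixes y F :: "real \<Rightarrow> 'a::euclidean_space"
  assumes \<alpha>: "0 < \<alpha>" "\<alpha> \<le> 1" and "c > 0"
    and y: "continuous_on {0..} y" and F: "continuous_on {0..} F"
    and eq: "\<And>t. t \<ge> 0 \<Longrightarrow> y t = y0 + conv (abel_kernel \<alpha> 0) F t"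
    and diss: "\<And>s. 0 \<le> s \<Longrightarrow> s \<le> t \<Longrightarrow> y s \<bullet> F s \<le> - c * (norm (y s))\<^sup>2"
    and F_le: "\<And>s. 0 \<le> s \<Longrightarrow> s \<le> t \<Longrightarrow> norm (F s) \<le> L * norm (y s)"
    and t: "0 \<le> t"
  shows "norm (y t) \<le> norm y0"
proof (rule volterra_bounded[OF \<alpha> _ _ _ y F eq _ t order_refl])
  define \<mu> where "\<mu> = L\<^sup>2 / c + c"
  have "L\<^sup>2 / c \<ge> 0" using \<open>c > 0\<close> by simp
  then show "\<mu> > 0" "0 \<le> \<mu> - c / 2" "\<mu> - c / 2 < \<mu>"
    using \<open>c > 0\<close> unfolding \<mu>_def by linarith+
  show "norm (F s + \<mu> *\<^sub>R y s) \<le> (\<mu> - c / 2) * norm (y s)" if "0 \<le> s" "s \<le> t" for s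
    by (rule norm_add_scaleR_le_of_dissipative[OF diss F_le \<open>c > 0\<close> \<mu>_def]) (use that in auto)
qed

lemma volterra_dissipative_tendsto_0:
  fixes y F :: "real \<Rightarrow> 'a::euclidean_space"
  assumes \<alpha>: "0 < \<alpha>" "\<alpha> \<le> 1" and "c > 0"
    and y: "continuous_on {0..} y" and F: "continuous_on {0..} F"
    and eq: "\<And>t. t \<ge> 0 \<Longrightarrow> y t = y0 + conv (abel_kernel \<alpha> 0) F t"
    and diss: "\<And>s. 0 \<le> s \<Longrightarrow> y s \<bullet> F s \<le> - c * (norm (y s))\<^sup>2"
    and F_le: "\<And>s. 0 \<le> s \<Longrightarrow> norm (F s) \<le> L * norm (y s)"
    and C: "\<And>s. 0 \<le> s \<Longrightarrow> norm (F s) \<le> C"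
  shows "(y \<longlongrightarrow> 0) at_top"
proof (rule volterra_tendsto_0[OF \<alpha> _ _ _ y F eq _ C])
  define \<mu> where "\<mu> = L\<^sup>2 / c + c"
  have "L\<^sup>2 / c \<ge> 0" using \<open>c > 0\<close> by simp
  then show "\<mu> > 0" "0 \<le> \<mu> - c / 2" "\<mu> - c / 2 < \<mu>"
    using \<open>c > 0\<close> unfolding \<mu>_def by linarith+
  show "norm (F s + \<mu> *\<^sub>R y s) \<le> (\<mu> - c / 2) * norm (y s)" if "0 \<le> s" for s
    by (rule norm_add_scaleR_le_of_dissipative[OF diss F_le \<open>c > 0\<close> \<mu>_def]) (use that in auto)
qed

text \<open>Every point of the ball has distance at least \<open>norm v - R\<close> from
  \<open>v\<close>, and the radial point attains it. That the projection is a multiple of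
  \<open>v\<close> is what carries dissipativity over to the cut-off field.\<close>

lemma closest_point_cball_0:
  fixes v :: "'a::euclidean_space"
  assumes "0 \<le> R" "R \<le> norm v"
  shows "closest_point (cball 0 R) v = (R / norm v) *\<^sub>R v"
proof (cases "v = 0")
  case True
  then show ?thesis using assms by (simp add: closest_point_self)
next
  case False
  have "norm (v - (R / norm v) *\<^sub>R v) \<le> norm (v - z)" if "norm z \<le> R" for z
  proof -
    have "v - (R / norm v) *\<^sub>R v = (1 - R / norm v) *\<^sub>R v" by (simp add: algebra_simps)
    moreover have "R / norm v \<le> 1" using assms False by simp
    ultimately have "norm (v - (R / norm v) *\<^sub>R v) = (1 - R / norm v) * norm v" by simp
    also have "\<dots> = norm v - R" using False by (simp add: field_simps)
    also have "\<dots> \<le> norm (v - z)" using that norm_triangle_ineq2[of v z] by simp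
    finally show ?thesis .
  qed
  then show ?thesis
    using assms False by (intro closest_point_unique[symmetric]) (auto simp: dist_norm)
qed

text \<open>Coordinates in which the equilibrium is 0 and the weighted norm is the Euclidean one.
  Lipschitz continuity is asked only on balls since the Maxwell-Bloch field is quadratic, while
  dissipativity is global.\<close>

locale dissipative_field =
  fixes f :: "'a::euclidean_space \<Rightarrow> 'a" and c :: real
  assumes zero: "f 0 = 0"
    and lip: "\<And>R. R \<ge> 0 \<Longrightarrow> \<exists>L. L-lipschitz_on (cball 0 R) f"
    and c_pos: "c > 0"
    and diss: "\<And>y. y \<bullet> f y \<le> - c * (norm y)\<^sup>2"
begin

lemma continuous_on_field: "continuous_on S f"
proof -
  have "continuous (at x) f" for x
  proof -
    obtain L where "L-lipschitz_on (cball 0 (norm x + 1)) f" using lip[of "norm x + 1"] by auto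
    then have "continuous_on (cball 0 (norm x + 1)) f" by (rule lipschitz_on_continuous_on)
    then show ?thesis by (rule continuous_on_interior) (simp add: interior_cball)
  qed
  then show ?thesis by (simp add: continuous_at_imp_continuous_on)
qed

lemma norm_field_le: "L-lipschitz_on (cball 0 R) f \<Longrightarrow> norm y \<le> R \<Longrightarrow> norm (f y) \<le> L * norm y"
  using lipschitz_onD[of L "cball 0 R" f y 0] zero
  by (auto simp: dist_norm intro: order_trans[OF norm_ge_zero])

context
  fixes \<alpha> :: real
  assumes \<alpha>: "0 < \<alpha>" "\<alpha> \<le> 1"
begin

lemma Gamma_order_pos: "1 / Gamma \<alpha> > 0"
  using \<alpha> by (simp add: Gamma_real_pos)

lemma scaled_diss: "y \<bullet> ((1 / Gamma \<alpha>) *\<^sub>R f y) \<le> - (c / Gamma \<alpha>) * (norm y)\<^sup>2"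
  using mult_left_mono[OF diss[of y] less_imp_le[OF Gamma_order_pos]] by (simp add: mult_ac)

lemma scaled_norm_le:
  "L-lipschitz_on (cball 0 R) f \<Longrightarrow> norm y \<le> R \<Longrightarrow> norm ((1 / Gamma \<alpha>) *\<^sub>R f y) \<le> L / Gamma \<alpha> * norm y"
  using mult_left_mono[OF norm_field_le[of L R y] less_imp_le[OF Gamma_order_pos]] \<alpha>
  by (simp add: Gamma_real_pos less_imp_le mult_ac)

text \<open>A Lipschitz constant is available only on balls, so it is taken on one containing the
  compact range of \<open>y\<close> on \<open>{0..t}\<close>; the resulting estimate no longer
  contains it.\<close>

lemma solution_norm_le:
  assumes sol: "caputo_solution \<alpha> f y0 y" and t: "t \<ge> 0"
  shows "norm (y t) \<le> norm y0"
proof -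
  have y: "continuous_on {0..} y" using sol by (simp add: caputo_solution_def)
  have "bounded (y ` {0..t})"
    by (intro compact_imp_bounded compact_continuous_image continuous_on_subset[OF y]) auto
  then obtain R where R: "R > 0" "\<And>s. s \<in> {0..t} \<Longrightarrow> norm (y s) \<le> R"
    unfolding bounded_pos by auto
  obtain L where L: "L-lipschitz_on (cball 0 R) f" using lip[of R] R by auto
  show ?thesis
  proof (rule volterra_dissipative_bounded[OF \<alpha> _ y _ _ scaled_diss scaled_norm_le[OF L] t])
    show "c / Gamma \<alpha> > 0" using c_pos \<alpha> by (simp add: Gamma_real_pos)
    show "continuous_on {0..} (\<lambda>s. (1 / Gamma \<alpha>) *\<^sub>R f (y s))"
      by (intro continuous_on_scaleR continuous_on_const continuous_on_compose2[OF continuous_on_field y subset_UNIV])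
    show "y t = y0 + conv (abel_kernel \<alpha> 0) (\<lambda>s. (1 / Gamma \<alpha>) *\<^sub>R f (y s)) t" if "t \<ge> 0" for t
      using sol that unfolding caputo_solution_iff_conv by blast
  qed (use R in auto)
qed

text \<open>The solution stays in the ball of radius \<open>norm y0\<close>, so a single Lipschitz
  constant serves for all times and also bounds the field along the solution, as the kernel error
  requires.\<close>

lemma solution_tendsto_0:
  assumes sol: "caputo_solution \<alpha> f y0 y"
  shows "(y \<longlongrightarrow> 0) at_top"
proof -
  have y: "continuous_on {0..} y" using sol by (simp add: caputo_solution_def)
  obtain L where L: "L-lipschitz_on (cball 0 (norm y0)) f" using lip[of "norm y0"] by auto
  have "L \<ge> 0" using L by (rule lipschitz_on_nonneg)
  note le = solution_norm_le[OF sol]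
  show ?thesis
  proof (rule volterra_dissipative_tendsto_0[OF \<alpha> _ y _ _ scaled_diss scaled_norm_le[OF L le]])
    show "c / Gamma \<alpha> > 0" using c_pos \<alpha> by (simp add: Gamma_real_pos)
    show "continuous_on {0..} (\<lambda>s. (1 / Gamma \<alpha>) *\<^sub>R f (y s))"
      by (intro continuous_on_scaleR continuous_on_const continuous_on_compose2[OF continuous_on_field y subset_UNIV])
    show "y t = y0 + conv (abel_kernel \<alpha> 0) (\<lambda>s. (1 / Gamma \<alpha>) *\<^sub>R f (y s)) t" if "t \<ge> 0" for t
      using sol that unfolding caputo_solution_iff_conv by blast
    show "norm ((1 / Gamma \<alpha>) *\<^sub>R f (y s)) \<le> L / Gamma \<alpha> * norm y0" if "s \<ge> 0" for s
    proof (rule order_trans[OF scaled_norm_le[OF L le[OF that]]])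
      show "L / Gamma \<alpha> * norm (y s) \<le> L / Gamma \<alpha> * norm y0"
        using le[OF that] \<open>L \<ge> 0\<close> \<alpha> by (intro mult_left_mono) (auto simp: Gamma_real_pos less_imp_le)
    qed
  qed
qed

text \<open>
  The field is cut off by projecting onto a ball of radius larger than \<open>norm y0\<close>. The cut-off field is still
  dissipative on bounded sets, so the bound \<open>norm (y t) \<le> norm y0\<close> shows that the cut-off is never active.
\<close>

lemma solution_exists: "\<exists>y. caputo_solution \<alpha> f y0 y"
proof -
  define R where "R = norm y0 + 1"
  have "R > 0" by (simp add: R_def add_nonneg_pos)
  obtain L where L: "L-lipschitz_on (cball 0 R) f" using lip[of R] \<open>R > 0\<close> by auto
  have "L \<ge> 0" using L by (rule lipschitz_on_nonneg)
  define p where "p = closest_point (cball (0::'a) R)"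
  have p_in: "p v \<in> cball 0 R" for v
    unfolding p_def using \<open>R > 0\<close> by (intro closest_point_in_set) auto
  have p_self: "p v = v" if "norm v \<le> R" for v
    unfolding p_def using that by (intro closest_point_self) auto
  have p_lip: "dist (p v) (p w) \<le> dist v w" for v w
    unfolding p_def using \<open>R > 0\<close> by (intro closest_point_lipschitz) auto
  define g where "g = (\<lambda>v. (1 / Gamma \<alpha>) *\<^sub>R f (p v))"
  have g_lip: "(L / Gamma \<alpha>)-lipschitz_on UNIV g"
  proof (rule lipschitz_onI)
    show "0 \<le> L / Gamma \<alpha>" using \<open>L \<ge> 0\<close> \<alpha> by (simp add: Gamma_real_pos less_imp_le)
    fix v w
    have "dist (f (p v)) (f (p w)) \<le> L * dist (p v) (p w)" by (rule lipschitz_onD[OF L p_in p_in])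
    also have "\<dots> \<le> L * dist v w" by (intro mult_left_mono p_lip \<open>L \<ge> 0\<close>)
    finally have "(1 / Gamma \<alpha>) * dist (f (p v)) (f (p w)) \<le> (1 / Gamma \<alpha>) * (L * dist v w)"
      using Gamma_order_pos by (intro mult_left_mono) auto
    moreover have "dist (g v) (g w) = (1 / Gamma \<alpha>) * dist (f (p v)) (f (p w))"
      using Gamma_order_pos by (simp add: g_def dist_norm flip: scaleR_diff_right)
    ultimately show "dist (g v) (g w) \<le> L / Gamma \<alpha> * dist v w" by simp
  qed
  have g_cont: "continuous_on UNIV g" by (rule lipschitz_on_continuous_on[OF g_lip])
  obtain y where y: "continuous_on {0..} y"
    and eq: "\<And>t. t \<ge> 0 \<Longrightarrow> y t = y0 + conv (abel_kernel \<alpha> 0) (\<lambda>s. g (y s)) t"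
    using volterra_solution_exists[OF weakly_singular_abel_kernel[OF \<alpha>] g_lip continuous_on_const, of y0 "norm y0"]
    by auto
  have p_norm: "norm (p v) \<le> norm v" for v
    using p_lip[of v 0] p_self[of 0] \<open>R > 0\<close> by simp
  have y_le: "norm (y t) \<le> norm y0" if t: "t \<ge> 0" for t
  proof -
    have "bounded (y ` {0..t})"
      by (intro compact_imp_bounded compact_continuous_image continuous_on_subset[OF y]) auto
    then obtain M0 where M0: "M0 > 0" "\<And>s. s \<in> {0..t} \<Longrightarrow> norm (y s) \<le> M0"
      unfolding bounded_pos by auto
    define M where "M = max M0 R"
    have M: "M \<ge> R" "\<And>s. 0 \<le> s \<Longrightarrow> s \<le> t \<Longrightarrow> norm (y s) \<le> M"
      using M0(2) by (auto simp: M_def le_max_iff_disj)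
    \<comment> \<open>Outside the ball \<open>v = (norm v / R) *\<^sub>R p v\<close>, hence
      \<open>v \<bullet> f (p v) \<le> - c * R * norm v\<close>. This is only linear in
      \<open>norm v\<close>; \<open>norm v \<le> M\<close> turns it into a quadratic bound with rate
      \<open>c * R / M\<close>. As \<open>M \<ge> R\<close>, this rate is at most \<open>c\<close>
      and serves inside the ball as well.\<close>
    define d where "d = c * (R / M)"
    have "d > 0" using c_pos \<open>R > 0\<close> M by (simp add: d_def)
    have p_diss: "v \<bullet> f (p v) \<le> - d * (norm v)\<^sup>2" if v: "norm v \<le> M" for v
    proof (cases "norm v \<le> R")
      case True
      have "d \<le> c" using c_pos M \<open>R > 0\<close> by (simp add: d_def field_simps)
      then have "d * (norm v)\<^sup>2 \<le> c * (norm v)\<^sup>2" by (intro mult_right_mono) auto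
      then show ?thesis using diss[of v] True by (simp add: p_self)
    next
      case False
      have pv: "p v = (R / norm v) *\<^sub>R v"
        unfolding p_def using False \<open>R > 0\<close> by (intro closest_point_cball_0) auto
      have nv: "norm v > 0" using False \<open>R > 0\<close> by linarith
      have "v = (norm v / R) *\<^sub>R p v" using pv nv \<open>R > 0\<close> by simp
      then have "v \<bullet> f (p v) = (norm v / R) * (p v \<bullet> f (p v))" by (metis inner_scaleR_left)
      also have "\<dots> \<le> (norm v / R) * (- c * (norm (p v))\<^sup>2)"
        using \<open>R > 0\<close> by (intro mult_left_mono diss) auto
      also have "norm (p v) = R" using pv nv \<open>R > 0\<close> by simp
      also have "(norm v / R) * (- c * R\<^sup>2) = - (c * R) * norm v"
        using \<open>R > 0\<close> by (simp add: power2_eq_square)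
      also have "\<dots> \<le> - d * (norm v)\<^sup>2"
      proof -
        have "d * (norm v)\<^sup>2 = c * R * norm v * (norm v / M)" by (simp add: d_def power2_eq_square)
        also have "\<dots> \<le> c * R * norm v * 1"
          using c_pos \<open>R > 0\<close> M(1) v nv by (intro mult_left_mono) auto
        finally show ?thesis by simp
      qed
      finally show ?thesis .
    qed
    show ?thesis
    proof (rule volterra_dissipative_bounded[OF \<alpha> _ y _ eq _ _ t])
      show "d / Gamma \<alpha> > 0" using \<open>d > 0\<close> \<alpha> by (simp add: Gamma_real_pos)
      show "continuous_on {0..} (\<lambda>s. g (y s))" by (rule continuous_on_compose2[OF g_cont y subset_UNIV])
      fix s assume s: "0 \<le> s" "s \<le> t"
      show "y s \<bullet> g (y s) \<le> - (d / Gamma \<alpha>) * (norm (y s))\<^sup>2"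
        using mult_left_mono[OF p_diss[OF M(2)[OF s]] less_imp_le[OF Gamma_order_pos]]
        by (simp add: g_def mult_ac)
      have "norm (g (y s)) \<le> L / Gamma \<alpha> * norm (p (y s))"
        unfolding g_def by (rule scaled_norm_le[OF L]) (use p_in[of "y s"] in simp)
      also have "\<dots> \<le> L / Gamma \<alpha> * norm (y s)"
        using \<open>L \<ge> 0\<close> \<alpha> by (intro mult_left_mono p_norm) (auto simp: Gamma_real_pos less_imp_le)
      finally show "norm (g (y s)) \<le> L / Gamma \<alpha> * norm (y s)" .
    qed
  qed
  have "y t = y0 + conv (abel_kernel \<alpha> 0) (\<lambda>s. (1 / Gamma \<alpha>) *\<^sub>R f (y s)) t" if "t \<ge> 0" for t
  proof -
    have "g (y s) = (1 / Gamma \<alpha>) *\<^sub>R f (y s)" if "s \<ge> 0" for s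
      using y_le[OF that] by (simp add: g_def p_self R_def)
    then have "conv (abel_kernel \<alpha> 0) (\<lambda>s. g (y s)) t
        = conv (abel_kernel \<alpha> 0) (\<lambda>s. (1 / Gamma \<alpha>) *\<^sub>R f (y s)) t"
      by (intro conv_cong) auto
    with eq[OF that] show ?thesis by simp
  qed
  with y show ?thesis unfolding caputo_solution_iff_conv by blast
qed

end

end

section \<open>Linear change of coordinates and transfer to the stability notions\<close>

lemma caputo_solution_affine:
  fixes f g :: "'a::euclidean_space \<Rightarrow> 'a"
  assumes \<alpha>: "0 < \<alpha>" "\<alpha> \<le> 1" and T: "bounded_linear T" and f: "continuous_on UNIV f"
    and g: "\<And>x. g (T (x - a) + b) = T (f x)" and sol: "caputo_solution \<alpha> f x0 x"
  shows "caputo_solution \<alpha> g (T (x0 - a) + b) (\<lambda>t. T (x t - a) + b)"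
proof -
  interpret T: bounded_linear T by fact
  have x: "continuous_on {0..} x"
    and eq: "\<And>t. t \<ge> 0 \<Longrightarrow> x t = x0 + conv (abel_kernel \<alpha> 0) (\<lambda>s. (1 / Gamma \<alpha>) *\<^sub>R f (x s)) t"
    using sol by (auto simp: caputo_solution_iff_conv)
  have fx: "continuous_on {0..t} (\<lambda>s. (1 / Gamma \<alpha>) *\<^sub>R f (x s))" for t
    by (intro continuous_on_scaleR continuous_on_const continuous_on_compose2[OF f] continuous_on_subset[OF x]) auto
  show ?thesis
    unfolding caputo_solution_iff_conv
  proof (intro conjI allI impI)
    show "continuous_on {0..} (\<lambda>t. T (x t - a) + b)"
      by (intro continuous_on_add continuous_on_const T.continuous_on continuous_on_diff x)
    fix t :: real assume t: "t \<ge> 0"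
    have "T (conv (abel_kernel \<alpha> 0) (\<lambda>s. (1 / Gamma \<alpha>) *\<^sub>R f (x s)) t)
        = conv (abel_kernel \<alpha> 0) (\<lambda>s. T ((1 / Gamma \<alpha>) *\<^sub>R f (x s))) t"
      using integral_linear[OF conv_singular_integrable[OF
            weakly_singular_integrable[OF weakly_singular_abel_kernel[OF \<alpha>] t] fx] T]
      by (simp add: conv_def o_def T.scaleR)
    then show "T (x t - a) + b = T (x0 - a) + b +
        conv (abel_kernel \<alpha> 0) (\<lambda>s. (1 / Gamma \<alpha>) *\<^sub>R g (T (x s - a) + b)) t"
      unfolding g using arg_cong[OF eq[OF t], of T] by (simp add: T.scaleR T.add T.diff)
  qed
qed

text \<open>\<open>(norm (T z))\<^sup>2\<close> plays the role of a quadratic Lyapunov function.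
  Conjugation with \<open>T\<close> makes it the squared Euclidean norm, so the results on
  dissipative fields apply to \<open>g\<close>, and \<open>T'\<close> carries solutions and
  estimates back.\<close>

theorem locally_asymptotically_stable_of_dissipative:
  fixes f T T' :: "'a::euclidean_space \<Rightarrow> 'a"
  assumes \<alpha>: "0 < \<alpha>" "\<alpha> \<le> 1"
    and T: "bounded_linear T" and T': "bounded_linear T'"
    and inv: "\<And>y. T (T' y) = y" "\<And>x. T' (T x) = x"
    and lip: "\<And>R. R \<ge> 0 \<Longrightarrow> \<exists>L. L-lipschitz_on (cball 0 R) f"
    and eq: "f xe = 0" and "c > 0"
    and diss: "\<And>z. T z \<bullet> T (f (xe + z)) \<le> - c * (norm (T z))\<^sup>2"
  shows "locally_asymptotically_stable \<alpha> f xe"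
proof -
  interpret T: bounded_linear T by fact
  interpret T': bounded_linear T' by fact
  obtain B where B: "B > 0" "\<And>x. norm (T x) \<le> norm x * B" using T.pos_bounded by auto
  obtain B' where B': "B' > 0" "\<And>x. norm (T' x) \<le> norm x * B'" using T'.pos_bounded by auto
  define g where "g = (\<lambda>y. T (f (xe + T' y)))"
  have lip_g: "\<exists>L. L-lipschitz_on (cball 0 R) g" if "R \<ge> 0" for R
  proof -
    have "norm xe + R * B' \<ge> 0" using that B'(1) by simp
    then obtain L where L: "L-lipschitz_on (cball 0 (norm xe + R * B')) f" using lip by blast
    have "L \<ge> 0" using L by (rule lipschitz_on_nonneg)
    have mem: "xe + T' y \<in> cball 0 (norm xe + R * B')" if "y \<in> cball 0 R" for y
    proof -
      have "norm (xe + T' y) \<le> norm xe + norm (T' y)" by (rule norm_triangle_ineq)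
      also have "norm (T' y) \<le> norm y * B'" by (rule B')
      also have "\<dots> \<le> R * B'" using that B'(1) by (intro mult_right_mono) auto
      finally show ?thesis by simp
    qed
    have "(B * L * B')-lipschitz_on (cball 0 R) g"
    proof (rule lipschitz_onI)
      show "0 \<le> B * L * B'" using B B' \<open>L \<ge> 0\<close> by simp
      fix y z :: 'a assume yz: "y \<in> cball 0 R" "z \<in> cball 0 R"
      have "dist (g y) (g z) = norm (T (f (xe + T' y) - f (xe + T' z)))"
        by (simp add: g_def dist_norm T.diff)
      also have "\<dots> \<le> dist (f (xe + T' y)) (f (xe + T' z)) * B"
        unfolding dist_norm by (rule B(2))
      also have "\<dots> \<le> (L * dist (xe + T' y) (xe + T' z)) * B"
        using B(1) by (intro mult_right_mono lipschitz_onD[OF L] mem yz) auto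
      also have "dist (xe + T' y) (xe + T' z) = norm (T' (y - z))" by (simp add: dist_norm T'.diff)
      also have "(L * norm (T' (y - z))) * B \<le> (L * (norm (y - z) * B')) * B"
        using B(1) \<open>L \<ge> 0\<close> by (intro mult_right_mono mult_left_mono B') auto
      finally show "dist (g y) (g z) \<le> B * L * B' * dist y z" by (simp add: dist_norm mult_ac)
    qed
    then show ?thesis ..
  qed
  interpret g: dissipative_field g c
  proof
    show "g 0 = 0" by (simp add: g_def T.zero T'.zero eq)
    show "y \<bullet> g y \<le> - c * (norm y)\<^sup>2" for y using diss[of "T' y"] by (simp add: g_def inv)
  qed (use lip_g \<open>c > 0\<close> in auto)
  have f_cont: "continuous_on UNIV f"
  proof -
    have "f = (\<lambda>x. T' (g (T (x - xe))))" by (simp add: g_def inv)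
    moreover have "continuous_on UNIV (\<lambda>x. T' (g (T (x - xe))))"
      by (intro T'.continuous_on continuous_on_compose2[OF g.continuous_on_field[of UNIV]] T.continuous_on
          continuous_on_diff continuous_on_id continuous_on_const subset_UNIV)
    ultimately show ?thesis by simp
  qed
  have fwd: "caputo_solution \<alpha> g (T (x0 - xe)) (\<lambda>t. T (x t - xe))" if "caputo_solution \<alpha> f x0 x" for x0 x
    using caputo_solution_affine[OF \<alpha> T f_cont _ that, of g xe 0] by (simp add: g_def inv)
  have ex: "\<exists>x. caputo_solution \<alpha> f x0 x" for x0
  proof -
    obtain y where "caputo_solution \<alpha> g (T (x0 - xe)) y" using g.solution_exists[OF \<alpha>] by blast
    from caputo_solution_affine[OF \<alpha> T' g.continuous_on_field _ this, of f 0 xe]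
    show ?thesis by (auto simp: g_def inv add.commute)
  qed
  have bound: "norm (x t - xe) \<le> B' * norm (T (x t - xe))" for x :: "real \<Rightarrow> 'a" and t
    using B'(2)[of "T (x t - xe)"] by (simp add: inv mult.commute)
  have stable: "norm (x t - xe) \<le> B * B' * norm (x0 - xe)" if "caputo_solution \<alpha> f x0 x" "t \<ge> 0" for x0 x t
  proof -
    have "norm (T (x t - xe)) \<le> norm (T (x0 - xe))"
      by (rule g.solution_norm_le[OF \<alpha> fwd[OF that(1)] that(2)])
    also have "\<dots> \<le> norm (x0 - xe) * B" by (rule B)
    finally have "B' * norm (T (x t - xe)) \<le> B' * (norm (x0 - xe) * B)" using B'(1) by simp
    with bound[of x t] show ?thesis by (simp add: mult_ac)
  qed
  have attractive: "((\<lambda>t. norm (x t - xe)) \<longlongrightarrow> 0) at_top" if "caputo_solution \<alpha> f x0 x" for x0 x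
  proof -
    have "((\<lambda>t. T' (T (x t - xe))) \<longlongrightarrow> T' 0) at_top"
      by (intro T'.tendsto g.solution_tendsto_0[OF \<alpha> fwd[OF that]])
    then show ?thesis by (simp add: inv T'.zero tendsto_norm_zero)
  qed
  show ?thesis
    unfolding locally_asymptotically_stable_def equilibrium_state_def lyapunov_stable_def locally_attractive_def
  proof (intro conjI allI impI)
    show "f xe = 0" by (rule eq)
  next
    fix \<epsilon> :: real assume "\<epsilon> > 0"
    show "\<exists>\<delta>>0. \<forall>x0. norm (x0 - xe) < \<delta> \<longrightarrow> (\<exists>x. caputo_solution \<alpha> f x0 x) \<and>
        (\<forall>x. caputo_solution \<alpha> f x0 x \<longrightarrow> (\<forall>t\<ge>0. norm (x t - xe) < \<epsilon>))"
    \<comment> \<open>\<open>B * B'\<close> is the price of passing from \<open>norm x\<close> to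
      \<open>norm (T x)\<close> and back.\<close>
    proof (intro exI[of _ "\<epsilon> / (B * B')"] conjI allI impI ex)
      show "\<epsilon> / (B * B') > 0" using \<open>\<epsilon> > 0\<close> B(1) B'(1) by simp
      fix x0 x and t :: real
      assume "norm (x0 - xe) < \<epsilon> / (B * B')" "caputo_solution \<alpha> f x0 x" "t \<ge> 0"
      then have "B * B' * norm (x0 - xe) < \<epsilon>" using B(1) B'(1) by (simp add: field_simps)
      then show "norm (x t - xe) < \<epsilon>"
        using stable[OF \<open>caputo_solution \<alpha> f x0 x\<close> \<open>t \<ge> 0\<close>] by simp
    qed
  next
    \<comment> \<open>Solutions from every initial value converge, so any radius is a
      witness.\<close>
    show "\<exists>\<delta>>0. \<forall>x0. norm (x0 - xe) < \<delta> \<longrightarrow> (\<exists>x. caputo_solution \<alpha> f x0 x) \<and>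
        (\<forall>x. caputo_solution \<alpha> f x0 x \<longrightarrow> ((\<lambda>t. norm (x t - xe)) \<longlongrightarrow> 0) at_top)"
      by (intro exI[of _ 1] conjI allI impI ex attractive) auto
  qed
qed

section \<open>The controlled Maxwell-Bloch system\<close>

lemma exhaust_5:
  fixes x :: 5
  shows "x = 1 \<or> x = 2 \<or> x = 3 \<or> x = 4 \<or> x = 5"
proof (induct x)
  case (of_int z)
  then have "z = 0 \<or> z = 1 \<or> z = 2 \<or> z = 3 \<or> z = 4" by fastforce
  then show ?case by auto
qed

lemma forall_5: "(\<forall>i::5. P i) \<longleftrightarrow> P 1 \<and> P 2 \<and> P 3 \<and> P 4 \<and> P 5"
  by (metis exhaust_5)

lemma sum_5: "sum f (UNIV::5 set) = f 1 + f 2 + f 3 + f 4 + f 5"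
proof -
  have UNIV_5: "(UNIV :: 5 set) = {1, 2, 3, 4, 5}" using exhaust_5 by auto
  show ?thesis unfolding UNIV_5 by (simp add: ac_simps)
qed

lemma vector_5 [simp]:
  "(vector [a, b, c, d, e] :: 'a::zero ^ 5) $ 1 = a"
  "(vector [a, b, c, d, e] :: 'a ^ 5) $ 2 = b"
  "(vector [a, b, c, d, e] :: 'a ^ 5) $ 3 = c"
  "(vector [a, b, c, d, e] :: 'a ^ 5) $ 4 = d"
  "(vector [a, b, c, d, e] :: 'a ^ 5) $ 5 = e"
  unfolding vector_def by simp_all

text \<open>The condition on \<open>p\<close> says that the form
  \<open>p * a * u^2 - (p + m) * u * v + b * v^2\<close> is positive definite. For
  \<open>m \<noteq> 0\<close> the quotient \<open>(p + m)^2 / p\<close> is smallest at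
  \<open>p = \<bar>m\<bar>\<close>, with value \<open>4 * m\<close> or 0 according to the sign of
  \<open>m\<close>, and both are below \<open>4 * a * b\<close>. For \<open>m = 0\<close> this
  choice would vanish, and \<open>a * b\<close> is taken.\<close>

lemma block_weight_exists:
  fixes a b m :: real
  assumes "a > 0" "b > 0" "m < a * b"
  obtains p where "p > 0" "(p + m)\<^sup>2 < 4 * p * (a * b)"
proof (cases "m = 0")
  case True
  show thesis by (rule that[of "a * b"]) (use assms True in \<open>auto simp: power2_eq_square\<close>)
next
  case False
  show thesis
  proof (rule that[of "\<bar>m\<bar>"])
    show "\<bar>m\<bar> > 0" using False by simp
    have "a * b > 0" using assms by simp
    show "(\<bar>m\<bar> + m)\<^sup>2 < 4 * \<bar>m\<bar> * (a * b)"
    proof (cases "m > 0")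
      case True
      then have "4 * m * m < 4 * m * (a * b)" using assms by (intro mult_strict_left_mono) auto
      with True show ?thesis by (simp add: power2_eq_square)
    next
      case nonpos: False
      then show ?thesis using \<open>m \<noteq> 0\<close> \<open>a * b > 0\<close> by (simp add: mult_neg_pos)
    qed
  qed
qed

text \<open>Here \<open>c\<close> is small enough for the form \<open>p (a - c) u\<^sup>2 - (p + m) u v + (b - c) v\<^sup>2\<close> to stay nonnegative.\<close>

lemma block_dissipative:
  fixes a b m p :: real
  assumes "a > 0" "b > 0" "p > 0" "(p + m)\<^sup>2 < 4 * p * (a * b)"
  obtains c where "c > 0" "\<And>u v. p * u * (v - a * u) + v * (m * u - b * v) \<le> - c * (p * u\<^sup>2 + v\<^sup>2)"
proof
  define D where "D = 4 * p * (a * b) - (p + m)\<^sup>2"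
  \<comment> \<open>Lowering \<open>a\<close> and \<open>b\<close> by \<open>c\<close> changes
    \<open>4 * p * a * b\<close> by \<open>- 4 * p * c * (a + b) + 4 * p * c\<^sup>2\<close>. With
    this \<open>c\<close> the first term uses up the surplus \<open>D\<close> exactly, and the
    nonnegative gap \<open>4 * p * c\<^sup>2\<close> is left.\<close>
  define c where "c = D / (4 * p * (a + b))"
  show "c > 0" using assms by (simp add: c_def D_def)
  have c: "4 * p * c * (a + b) = D" using assms by (simp add: c_def)
  have "4 * p * (c * (a + b)) \<le> 4 * p * (a * b)" using c by (simp add: D_def mult.assoc)
  then have "c * (a + b) \<le> a * b" using assms by simp
  then have "c * a < a * b" using \<open>c > 0\<close> assms by (smt (verit) distrib_left mult_pos_pos)
  then have "c < b" using assms by (simp add: mult.commute)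
  have "c * b < a * b" using \<open>c * (a + b) \<le> a * b\<close> \<open>c > 0\<close> assms by (smt (verit) distrib_left mult_pos_pos)
  then have "c < a" using assms by simp
  have disc: "4 * p * (a - c) * (b - c) - (p + m)\<^sup>2 = 4 * p * c\<^sup>2"
    using c by (simp add: D_def power2_eq_square algebra_simps)
  fix u v
  define Q where "Q = p * (a - c) * u\<^sup>2 - (p + m) * u * v + (b - c) * v\<^sup>2"
  have "(4 * p * (a - c)) * Q = (2 * p * (a - c) * u - (p + m) * v)\<^sup>2 + (4 * p * (a - c) * (b - c) - (p + m)\<^sup>2) * v\<^sup>2"
    unfolding Q_def by (simp add: power2_eq_square algebra_simps)
  also have "\<dots> \<ge> 0" unfolding disc using assms by simp
  finally have "(4 * p * (a - c)) * Q \<ge> 0" .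
  moreover have "4 * p * (a - c) > 0" using \<open>c < a\<close> assms by simp
  ultimately have "Q \<ge> 0" by (meson mult_pos_neg not_le)
  then show "p * u * (v - a * u) + v * (m * u - b * v) \<le> - c * (p * u\<^sup>2 + v\<^sup>2)"
    unfolding Q_def by (simp add: power2_eq_square algebra_simps)
qed

text \<open>The constant adds up component estimates in the \<open>l^1\<close> norm: 1 for each of
  the two linear couplings, \<open>2 * R\<close> for each of the four products, and one coefficient
  per damping term.\<close>

lemma lipschitz_controlled_maxwell_bloch:
  assumes "k1 > 0" "k2 > 0" "k3 > 0" "k4 > 0" "k5 > 0" "R \<ge> 0"
  shows "(2 + 8 * R + k1 + k2 + k3 + k4 + k5)-lipschitz_on (cball 0 R) (controlled_maxwell_bloch k1 k2 k3 k4 k5 m)"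
proof (rule lipschitz_onI)
  show "0 \<le> 2 + 8 * R + k1 + k2 + k3 + k4 + k5" using assms by simp
  fix x y :: "real ^ 5" assume "x \<in> cball 0 R" "y \<in> cball 0 R"
  then have R: "norm x \<le> R" "norm y \<le> R" by auto
  define f where "f = controlled_maxwell_bloch k1 k2 k3 k4 k5 m"
  define d where "d = norm (x - y)"
  have d: "\<bar>x $ i - y $ i\<bar> \<le> d" for i
    using component_le_norm_cart[of "x - y" i] by (simp add: d_def)
  have kd: "\<bar>k * x $ i - k * y $ i\<bar> \<le> k * d" if "k > 0" for k i
    using mult_left_mono[OF d[of i], of k] that by (simp add: abs_mult flip: right_diff_distrib)
  have prod: "\<bar>x $ i * x $ j - y $ i * y $ j\<bar> \<le> 2 * R * d" for i j
  proof -
    have "x $ i * x $ j - y $ i * y $ j = x $ i * (x $ j - y $ j) + (x $ i - y $ i) * y $ j"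
      by (simp add: algebra_simps)
    also have "\<bar>\<dots>\<bar> \<le> \<bar>x $ i\<bar> * \<bar>x $ j - y $ j\<bar> + \<bar>x $ i - y $ i\<bar> * \<bar>y $ j\<bar>"
      by (metis abs_mult abs_triangle_ineq)
    also have "\<dots> \<le> R * d + d * R"
      by (intro add_mono mult_mono d order_trans[OF component_le_norm_cart] R) (use assms in \<open>auto simp: d_def\<close>)
    finally show ?thesis by simp
  qed
  have "dist (f x) (f y) \<le> (\<Sum>i\<in>UNIV. \<bar>(f x - f y) $ i\<bar>)"
    unfolding dist_norm by (rule norm_le_l1_cart)
  also have "\<dots> \<le> (1 + k1) * d + (1 + k2) * d + (2 * R + k3) * d + (2 * R + k4) * d + (4 * R + k5) * d"
  proof -
    have "\<bar>(f x - f y) $ 1\<bar> \<le> (1 + k1) * d"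
      using d[of 3] kd[OF assms(1), of 1] by (simp add: f_def controlled_maxwell_bloch_def distrib_right)
    moreover have "\<bar>(f x - f y) $ 2\<bar> \<le> (1 + k2) * d"
      using d[of 4] kd[OF assms(2), of 2] by (simp add: f_def controlled_maxwell_bloch_def distrib_right)
    moreover have "\<bar>(f x - f y) $ 3\<bar> \<le> (2 * R + k3) * d"
      using prod[of 1 5] kd[OF assms(3), of 3] by (simp add: f_def controlled_maxwell_bloch_def distrib_right)
    moreover have "\<bar>(f x - f y) $ 4\<bar> \<le> (2 * R + k4) * d"
      using prod[of 2 5] kd[OF assms(4), of 4] by (simp add: f_def controlled_maxwell_bloch_def distrib_right)
    moreover have "\<bar>(f x - f y) $ 5\<bar> \<le> (4 * R + k5) * d"
      using prod[of 1 3] prod[of 2 4] kd[OF assms(5), of 5]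
      by (simp add: f_def controlled_maxwell_bloch_def distrib_right right_diff_distrib)
    ultimately show ?thesis unfolding sum_5 by linarith
  qed
  also have "\<dots> = (2 + 8 * R + k1 + k2 + k3 + k4 + k5) * dist x y" by (simp add: d_def dist_norm algebra_simps)
  finally show "dist (f x) (f y) \<le> (2 + 8 * R + k1 + k2 + k3 + k4 + k5) * dist x y" .
qed

lemma controlled_maxwell_bloch_stable:
  assumes k: "k1 > 0" "k2 > 0" "k3 > 0" "k4 > 0" "k5 > 0"
    and \<alpha>: "0 < \<alpha>" "\<alpha> \<le> 1" and m: "m < k1 * k3" "m < k2 * k4"
  shows "locally_asymptotically_stable \<alpha> (controlled_maxwell_bloch k1 k2 k3 k4 k5 m) (e2 m)"
proof -
  define f where "f = controlled_maxwell_bloch k1 k2 k3 k4 k5 m"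
  obtain p where p: "p > 0" "(p + m)\<^sup>2 < 4 * p * (k1 * k3)" using block_weight_exists k m by metis
  obtain q where q: "q > 0" "(q + m)\<^sup>2 < 4 * q * (k2 * k4)" using block_weight_exists k m by metis
  obtain c1 where c1: "c1 > 0"
    "\<And>u v. p * u * (v - k1 * u) + v * (m * u - k3 * v) \<le> - c1 * (p * u\<^sup>2 + v\<^sup>2)"
    using block_dissipative[OF k(1,3) p] by metis
  obtain c2 where c2: "c2 > 0"
    "\<And>u v. q * u * (v - k2 * u) + v * (m * u - k4 * v) \<le> - c2 * (q * u\<^sup>2 + v\<^sup>2)"
    using block_dissipative[OF k(2,4) q] by metis
  define c where "c = min (min c1 c2) k5"
  \<comment> \<open>The third, fourth and fifth weights agree so that the cubic terms
    \<open>z$1 * z$3 * z$5\<close> and \<open>z$2 * z$4 * z$5\<close> cancel against those of the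
    fifth equation. The first two remain free and are adapted to the blocks; the square roots appear
    because the squared weights enter the norm.\<close>
  define w :: "real ^ 5" where "w = vector [sqrt p, sqrt q, 1, 1, 1]"
  define T where "T = (\<lambda>x :: real ^ 5. \<chi> i. w $ i * x $ i)"
  define T' where "T' = (\<lambda>x :: real ^ 5. \<chi> i. x $ i / w $ i)"
  have w: "w $ i \<noteq> 0" for i
    using exhaust_5[of i] p q by (auto simp: w_def)
  show ?thesis
  proof (rule locally_asymptotically_stable_of_dissipative[of \<alpha> T T' _ _ c, OF \<alpha>])
    show "bounded_linear T" "bounded_linear T'"
      unfolding T_def T'_def linear_conv_bounded_linear[symmetric]
      by (intro linearI; simp add: vec_eq_iff algebra_simps add_divide_distrib)+
    show "T (T' y) = y" "T' (T y) = y" for y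
      using w by (auto simp: T_def T'_def vec_eq_iff)
    show "\<exists>L. L-lipschitz_on (cball 0 R) (controlled_maxwell_bloch k1 k2 k3 k4 k5 m)" if "R \<ge> 0" for R
      using lipschitz_controlled_maxwell_bloch[OF k that] by blast
    show "controlled_maxwell_bloch k1 k2 k3 k4 k5 m (e2 m) = 0"
      by (simp add: vec_eq_iff forall_5 controlled_maxwell_bloch_def e2_def)
    show "c > 0" using c1 c2 k by (simp add: c_def)
    fix z :: "real ^ 5"
    have "s * a * (s * b) = s * s * a * b" for s a b :: real by (simp only: mult_ac)
    then have sq: "sqrt p * a * (sqrt p * b) = p * a * b" "sqrt q * a * (sqrt q * b) = q * a * b" for a b
      using p q by simp_all
    have n: "(norm (T z))\<^sup>2 = (p * (z$1)\<^sup>2 + (z$3)\<^sup>2) + (q * (z$2)\<^sup>2 + (z$4)\<^sup>2) + (z$5)\<^sup>2"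
      unfolding power2_norm_eq_inner
      by (simp add: inner_vec_def sum_5 T_def w_def sq power2_eq_square)
    have "T z \<bullet> T (f (e2 m + z))
        = (p * z$1 * (z$3 - k1 * z$1) + z$3 * (m * z$1 - k3 * z$3))
        + (q * z$2 * (z$4 - k2 * z$2) + z$4 * (m * z$2 - k4 * z$4)) - k5 * (z$5)\<^sup>2"
      by (simp add: inner_vec_def sum_5 T_def w_def sq f_def controlled_maxwell_bloch_def e2_def
          power2_eq_square) (simp add: algebra_simps)
    also have "\<dots> \<le> - c1 * (p * (z$1)\<^sup>2 + (z$3)\<^sup>2) + - c2 * (q * (z$2)\<^sup>2 + (z$4)\<^sup>2) - k5 * (z$5)\<^sup>2"
      by (intro diff_mono add_mono c1 c2) auto
    also have "\<dots> \<le> - c * (norm (T z))\<^sup>2"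
    proof -
      have "c * (p * (z$1)\<^sup>2 + (z$3)\<^sup>2) \<le> c1 * (p * (z$1)\<^sup>2 + (z$3)\<^sup>2)"
        "c * (q * (z$2)\<^sup>2 + (z$4)\<^sup>2) \<le> c2 * (q * (z$2)\<^sup>2 + (z$4)\<^sup>2)"
        "c * (z$5)\<^sup>2 \<le> k5 * (z$5)\<^sup>2"
        using p q by (intro mult_right_mono; simp add: c_def)+
      then show ?thesis unfolding n by (simp add: distrib_left)
    qed
    finally show "T z \<bullet> T (controlled_maxwell_bloch k1 k2 k3 k4 k5 m (e2 m + z)) \<le> - c * (norm (T z))\<^sup>2"
      by (simp add: f_def)
  qed
qed

theorem proposition4p2:
  fixes \<alpha> k1 k2 k3 k4 k5 m :: real
  assumes k_pos: "k1 > 0" "k2 > 0" "k3 > 0" "k4 > 0" "k5 > 0"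
    and alpha: "0 < \<alpha>" "\<alpha> \<le> 1"
    and cond:
      "(\<bar>k1 - k3\<bar> = \<bar>k2 - k4\<bar> \<and> m = - (1/4) * (k1 - k3)\<^sup>2 \<and> m \<noteq> 0) \<or>
       (max (- (1/4) * (k1 - k3)\<^sup>2) (- (1/4) * (k2 - k4)\<^sup>2) < m \<and>
          m < min (k1 * k3) (k2 * k4)) \<or>
       (- (1/4) * (k1 - k3)\<^sup>2 < m \<and> m < min (- (1/4) * (k2 - k4)\<^sup>2) (k1 * k3)) \<or>
       (- (1/4) * (k2 - k4)\<^sup>2 < m \<and> m < min (- (1/4) * (k1 - k3)\<^sup>2) (k2 * k4)) \<or>
       m < min (- (1/4) * (k1 - k3)\<^sup>2) (- (1/4) * (k2 - k4)\<^sup>2)"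
  shows "locally_asymptotically_stable \<alpha> (controlled_maxwell_bloch k1 k2 k3 k4 k5 m) (e2 m)"
proof (rule controlled_maxwell_bloch_stable[OF k_pos alpha])
  \<comment> \<open>Outside the second alternative these signs give \<open>m \<le> 0\<close>, which
    lies below both products.\<close>
  have *: "- (1/4) * (k1 - k3)\<^sup>2 \<le> 0" "- (1/4) * (k2 - k4)\<^sup>2 \<le> 0" "k1 * k3 > 0" "k2 * k4 > 0"
    using k_pos by auto
  show "m < k1 * k3" using cond * by linarith
  show "m < k2 * k4" using cond * by linarith
qed

end
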